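(* Let $n\geq1$ and let $f:\mathrm{LT}(n)\to\mathrm{LT}(n)$ be a linear map which is self-adjoint and positive definite with respect to $\langle\cdot|\cdot\rangle$. Let $\mathrm{hor}_L:T_L\mathrm{LT}^+(n)\to\mathcal{H}_L$ be the orthogonal horizontal projection and $\mathrm{Exp}^{\mathrm{LC}}$ the Riemannian exponential map of the left-invariant metric $\mathrm{LC}(f)$ on $\mathrm{LT}^+(n)$. For all $L\in\mathrm{LT}^+(n)$, with $\Gamma=\mathrm{Diag}(L)^{-1}L\in\mathrm{LT}^1(n)$, all $\xi\in T_\Gamma\mathrm{LT}^1(n)\simeq\mathrm{LT}^0(n)$ and all $t\in\mathbb{R}$, the quotient-Lie-Cholesky metric $g^{\mathrm{QLC}}$ on $\mathrm{LT}^1(n)$ satisfies: - (Horizontal lift) $\xi^\#_L=\mathrm{hor}_L(\mathrm{Diag}(L)\,\xi)$; - (Riemannian metric) $g^{\mathrm{QLC}}_\Gamma(\xi,\xi)=\langle f(\Gamma^{-1}\mathrm{hor}_\Gamma(\xi))|\Gamma^{-1}\mathrm{hor}_\Gamma(\xi)\rangle$; - (Exponential map) $\mathrm{Exp}^{\mathrm{QLC}}_\Gamma(t\xi)=\mathrm{Diag}\big(\mathrm{Exp}^{\mathrm{LC}}_\Gamma(t\,\mathrm{hor}_\Gamma(\xi))\big)^{-1}\,\mathrm{Exp}^{\mathrm{LC}}_\Gamma(t\,\mathrm{hor}_\Gamma(\xi))$. In particular, quotient-Lie-Cholesky metrics are geodesically complete.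
   Context: $\mathrm{LT}(n)$: real $n\times n$ lower triangular matrices; $\mathrm{LT}^+(n)$: Lie group (matrix multiplication) of lower triangular matrices with positive diagonal; $\mathrm{LT}^1(n)$: lower triangular matrices with unit diagonal (a submanifold of $\mathrm{LT}^+(n)$); $\mathrm{LT}^0(n)$: lower triangular matrices with zero diagonal; $\mathrm{Diag}(M)$: the diagonal matrix with the same diagonal as $M$. The inner product $\langle\cdot|\cdot\rangle$ on $\mathrm{LT}(n)$ is defined by $\langle Z|Z\rangle=\mathrm{tr}(ZZ^\top)+\mathrm{tr}(\mathrm{Diag}(Z)^2)$. The metric $\mathrm{LC}(f)$ on $\mathrm{LT}^+(n)$ is the left-invariant Riemannian metric $g^{\mathrm{LC}}_L(Z,Z')=\langle f(L^{-1}Z)|L^{-1}Z'\rangle$, $Z,Z'\in T_L\mathrm{LT}^+(n)\simeq\mathrm{LT}(n)$. The group $\mathrm{Diag}^+(n)$ of positive diagonal matrices acts on $\mathrm{LT}^+(n)$ by left multiplication, isometrically for $\mathrm{LC}(f)$, and its orbits are the fibers of the submersion $\pi:\mathrm{LT}^+(n)\to\mathrm{LT}^1(n)$, $\pi(L)=\mathrm{Diag}(L)^{-1}L$. Put $\mathcal{V}_L=\ker d_L\pi$ and let $\mathcal{H}_L$ be its orthogonal complement for $\mathrm{LC}(f)$; $\mathrm{hor}_L$ is the orthogonal projection onto $\mathcal{H}_L$. For $\xi\in T_{\pi(L)}\mathrm{LT}^1(n)$, the horizontal lift $\xi^\#_L$ is the unique element of $\mathcal{H}_L$ with $d_L\pi(\xi^\#_L)=\xi$.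 The quotient-Lie-Cholesky metric $g^{\mathrm{QLC}}$ on $\mathrm{LT}^1(n)$ is the quotient metric $g^{\mathrm{QLC}}_{\pi(L)}(\xi,\xi)=g^{\mathrm{LC}}_L(\xi^\#_L,\xi^\#_L)$, i.e. the one making $\pi$ a Riemannian submersion; $\mathrm{Exp}^{\mathrm{QLC}}$ is its Riemannian exponential map. (On full-rank correlation matrices, quotient-Lie-Cholesky metrics are the pushforwards of these by the diffeomorphism $L\in\mathrm{LT}^1(n)\mapsto\mathrm{Diag}(LL^\top)^{-1/2}LL^\top\mathrm{Diag}(LL^\top)^{-1/2}$.) *)

theory Defs
  imports "HOL-Analysis.Analysis"
begin

text \<open>The n x n real matrices are the type \<open>real^'n^'n\<close> with \<open>n = CARD('n) \<ge> 1\<close>; the linear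
  order on the finite index type \<open>'n\<close> identifies it with \<open>{1..n}\<close>.\<close>

type_synonym 'n sqmat = "((real, 'n) vec, 'n) vec"

subsection \<open>Lower triangular matrices\<close>

definition LTri :: "'n::{finite,linorder} sqmat set" where
  "LTri = {M. \<forall>i j. i < j \<longrightarrow> M $ i $ j = 0}"

definition LTpos :: "'n::{finite,linorder} sqmat set" where
  "LTpos = {M \<in> LTri. \<forall>i. M $ i $ i > 0}"

definition LT1 :: "'n::{finite,linorder} sqmat set" where
  "LT1 = {M \<in> LTri. \<forall>i. M $ i $ i = 1}"

definition LT0 :: "'n::{finite,linorder} sqmat set" where
  "LT0 = {M \<in> LTri. \<forall>i. M $ i $ i = 0}"

definition Diag :: "'n::finite sqmat \<Rightarrow> 'n sqmat" where
  "Diag M = (\<chi> i j. if i = j then M $ i $ j else 0)"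

text \<open>The polarization of \<open>Z \<mapsto> tr (Z Z\<^sup>T) + tr (Diag(Z)\<^sup>2)\<close>.\<close>

definition lt_inner :: "'n::finite sqmat \<Rightarrow> 'n sqmat \<Rightarrow> real" where
  "lt_inner Z W = trace (Z ** transpose W) + trace (Diag Z ** Diag W)"


subsection \<open>Geodesics and the Riemannian exponential map\<close>

text \<open>All manifolds here are relatively open subsets \<open>S\<close> of an affine subspace with direction \<open>V\<close>
  in a Euclidean space, so every tangent space is \<open>V\<close>, and a Riemannian metric is a family \<open>g p\<close>
  (\<open>p \<in> S\<close>) of inner products on \<open>V\<close>. An affine chart is thus global, and the Levi-Civita
  connection is given there by its Christoffel map. Values of \<open>g\<close> outside \<open>S\<close> and \<open>V\<close> are irrelevant.\<close>

definition dir_deriv :: "('a::real_vector \<Rightarrow> real) \<Rightarrow> 'a \<Rightarrow> 'a \<Rightarrow> real" where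
  "dir_deriv F p u = deriv (\<lambda>s::real. F (p + s *\<^sub>R u)) 0"

text \<open>The Koszul formula for the (commuting) constant vector fields \<open>u\<close>, \<open>v\<close>, \<open>z\<close>:
  \<open>christoffel V g p u v\<close> is the value at \<open>p\<close> of the covariant derivative of \<open>v\<close> along \<open>u\<close>.\<close>

definition christoffel ::
  "'a::real_vector set \<Rightarrow> ('a \<Rightarrow> 'a \<Rightarrow> 'a \<Rightarrow> real) \<Rightarrow> 'a \<Rightarrow> 'a \<Rightarrow> 'a \<Rightarrow> 'a" where
  "christoffel V g p u v =
     (THE w. w \<in> V \<and> (\<forall>z\<in>V. 2 * g p w z =
        dir_deriv (\<lambda>q. g q v z) p u + dir_deriv (\<lambda>q. g q u z) p v - dir_deriv (\<lambda>q. g q u v) p z))"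

text \<open>Solutions of the geodesic equation on a nondegenerate interval \<open>I\<close>, with one-sided derivatives
  at endpoints belonging to \<open>I\<close>.\<close>

definition is_geodesic ::
  "'a::real_normed_vector set \<Rightarrow> 'a set \<Rightarrow> ('a \<Rightarrow> 'a \<Rightarrow> 'a \<Rightarrow> real) \<Rightarrow> real set \<Rightarrow> (real \<Rightarrow> 'a) \<Rightarrow> bool" where
  "is_geodesic V S g I \<gamma> \<longleftrightarrow>
     (\<forall>t\<in>I. \<gamma> t \<in> S) \<and>
     (\<exists>\<gamma>'. \<forall>t\<in>I. (\<gamma> has_vector_derivative \<gamma>' t) (at t within I) \<and>
        (\<gamma>' has_vector_derivative - christoffel V g (\<gamma> t) (\<gamma>' t) (\<gamma>' t)) (at t within I))"

definition has_riem_exp ::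
  "'a::real_normed_vector set \<Rightarrow> 'a set \<Rightarrow> ('a \<Rightarrow> 'a \<Rightarrow> 'a \<Rightarrow> real) \<Rightarrow> 'a \<Rightarrow> 'a \<Rightarrow> 'a \<Rightarrow> bool" where
  "has_riem_exp V S g p v q \<longleftrightarrow>
     (\<exists>\<gamma>. is_geodesic V S g {0..1} \<gamma> \<and> \<gamma> 0 = p \<and>
        (\<gamma> has_vector_derivative v) (at 0 within {0..1}) \<and> \<gamma> 1 = q)"

definition riem_exp_domain ::
  "'a::real_normed_vector set \<Rightarrow> 'a set \<Rightarrow> ('a \<Rightarrow> 'a \<Rightarrow> 'a \<Rightarrow> real) \<Rightarrow> 'a \<Rightarrow> 'a set" where
  "riem_exp_domain V S g p = {v \<in> V. \<exists>q. has_riem_exp V S g p v q}"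

definition riem_exp ::
  "'a::real_normed_vector set \<Rightarrow> 'a set \<Rightarrow> ('a \<Rightarrow> 'a \<Rightarrow> 'a \<Rightarrow> real) \<Rightarrow> 'a \<Rightarrow> 'a \<Rightarrow> 'a" where
  "riem_exp V S g p v = (THE q. has_riem_exp V S g p v q)"

definition geodesically_complete ::
  "'a::real_normed_vector set \<Rightarrow> 'a set \<Rightarrow> ('a \<Rightarrow> 'a \<Rightarrow> 'a \<Rightarrow> real) \<Rightarrow> bool" where
  "geodesically_complete V S g \<longleftrightarrow>
     (\<forall>p\<in>S. \<forall>v\<in>V. \<exists>\<gamma>. is_geodesic V S g UNIV \<gamma> \<and> \<gamma> 0 = p \<and>
        (\<gamma> has_vector_derivative v) (at 0))"


subsection \<open>Lie-Cholesky and quotient-Lie-Cholesky metrics\<close>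

definition LC ::
  "('n::finite sqmat \<Rightarrow> 'n sqmat) \<Rightarrow> 'n sqmat \<Rightarrow> 'n sqmat \<Rightarrow> 'n sqmat \<Rightarrow> real" where
  "LC f L Z Z' = lt_inner (f (matrix_inv L ** Z)) (matrix_inv L ** Z')"

definition lt_proj :: "'n::finite sqmat \<Rightarrow> 'n sqmat" where
  "lt_proj L = matrix_inv (Diag L) ** L"

text \<open>The formula for \<open>lt_proj\<close> is smooth on the open set of all matrices with nonzero diagonal
  entries; the differential of the submersion at \<open>L \<in> LTpos\<close> is the restriction to \<open>LTri\<close> of the
  derivative taken there.\<close>

definition d_proj :: "'n::finite sqmat \<Rightarrow> 'n sqmat \<Rightarrow> 'n sqmat" where
  "d_proj L = frechet_derivative lt_proj (at L)"

definition vertical :: "'n sqmat \<Rightarrow> 'n::{finite,linorder} sqmat set" where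
  "vertical L = {Z \<in> LTri. d_proj L Z = 0}"

definition horizontal ::
  "('n sqmat \<Rightarrow> 'n sqmat) \<Rightarrow> 'n sqmat \<Rightarrow> 'n::{finite,linorder} sqmat set" where
  "horizontal f L = {Z \<in> LTri. \<forall>W\<in>vertical L. LC f L Z W = 0}"

definition hor ::
  "('n sqmat \<Rightarrow> 'n sqmat) \<Rightarrow> 'n sqmat \<Rightarrow> 'n sqmat \<Rightarrow> 'n::{finite,linorder} sqmat" where
  "hor f L Z = (THE H. H \<in> horizontal f L \<and> Z - H \<in> vertical L)"

definition hor_lift ::
  "('n sqmat \<Rightarrow> 'n sqmat) \<Rightarrow> 'n sqmat \<Rightarrow> 'n sqmat \<Rightarrow> 'n::{finite,linorder} sqmat" where
  "hor_lift f L \<xi> = (THE H. H \<in> horizontal f L \<and> d_proj L H = \<xi>)"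

text \<open>The common value, over all \<open>L\<close> in the fiber above \<open>\<Gamma>\<close>, of the metric on horizontal lifts.\<close>

definition QLC ::
  "('n sqmat \<Rightarrow> 'n sqmat) \<Rightarrow> 'n sqmat \<Rightarrow> 'n sqmat \<Rightarrow> 'n::{finite,linorder} sqmat \<Rightarrow> real" where
  "QLC f \<Gamma> \<xi> \<eta> =
     (THE r. \<forall>L\<in>LTpos. lt_proj L = \<Gamma> \<longrightarrow> LC f L (hor_lift f L \<xi>) (hor_lift f L \<eta>) = r)"

end

theory Submission
  imports Defs
begin

text \<open>In the trivialization \<open>w = L\<^sup>-\<^sup>1 L'\<close> the geodesics of \<open>LC(f)\<close> are the solutions of \<open>L' = L w\<close>,
  \<open>w' = A(w)\<close>, where \<open>A\<close> is the Euler-Arnold field \<open>\<langle>f(A(w)) | z\<rangle> = \<langle>f(w) | [w, z]\<rangle>\<close>. The energy is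
  conserved, so these solutions are global, and the momentum along the orbits of the diagonal group is
  conserved, so an initially horizontal geodesic stays horizontal. Its projection \<open>\<Gamma>\<close> solves
  \<open>\<Gamma>' = \<Gamma> w - Diag(w) \<Gamma>\<close> with the same \<open>w\<close>. Conversely, the Euler-Lagrange equation of the quotient metric
  for \<open>\<Gamma>\<close>, expressed through \<open>w = \<Gamma>\<^sup>-\<^sup>1 hor(\<Gamma>')\<close>, is exactly this system; its solutions are determined by
  their initial values, so the two exponential maps correspond.\<close>

subsection \<open>Ordinary differential equations\<close>

text \<open>Both systems share \<open>w\<close> because left-trivialized data do not see the
  diagonal group: the fiber over \<open>\<Gamma>\<close> consists of the points
  \<open>dg d ** \<Gamma>\<close>, and since diagonal matrices commute, the trivialized vertical
  vectors \<open>Ad q e\<close> are the same for all \<open>q\<close> in a fiber. Horizontality of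
  \<open>w\<close> is thus a condition on \<open>\<Gamma>\<close> alone.

  The delicate point is a count of equations. The quotient equation is tested on \<open>LT0\<close>,
  the Euler-Arnold equation on \<open>LTri\<close>, which has \<open>CARD('n)\<close> more
  dimensions. The range of \<open>Ad \<Gamma>\<close> complements \<open>LT0\<close> in
  \<open>LTri\<close>, and on it the equation is the time derivative of the constraint that
  \<open>w\<close> is horizontal.

  The Christoffel map, the horizontal projection, the quotient metric and both exponentials are
  definite descriptions, so each needs existence and uniqueness before use. Moreover
  \<open>f\<close> and the metrics are controlled only on subspaces and submanifolds, while
  derivatives are taken in the whole matrix space; hence the extensions \<open>Q\<close> and
  \<open>omega\<close>, the latter by an explicit Gram-matrix formula whose smoothness the
  description \<open>hor\<close> would not show.\<close>

lemma antiderivative_real: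
  fixes g :: "real \<Rightarrow> 'a::banach"
  assumes "continuous_on UNIV g"
  shows "\<exists>G. G 0 = 0 \<and> (\<forall>t. (G has_vector_derivative g t) (at t))"
proof -
  \<comment> \<open>One of the two intervals is empty or a point, so this is the oriented integral
    from 0, for either sign of \<open>t\<close>.\<close>
  define G where "G t = integral {0..t} g - integral {t..0} g" for t
  have int: "g integrable_on {a..b}" for a b :: real
    by (rule integrable_continuous_real) (use assms continuous_on_subset in blast)
  \<comment> \<open>Rebased at \<open>- N\<close>, the integral has one formula on both sides of 0,
    so the fundamental theorem applies at 0 as well.\<close>
  have G_shift: "G t = integral {- N..t} g - integral {- N..0} g" if "- N \<le> t" "0 \<le> N" for N t
  proof (cases "0 \<le> t")
    case True
    have "integral {- N..0} g + integral {0..t} g = integral {- N..t} g"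
      by (rule Henstock_Kurzweil_Integration.integral_combine) (use True that int in auto)
    moreover have "integral {t..0} g = 0" using True by (cases "t = 0") auto
    ultimately show ?thesis by (simp add: G_def algebra_simps)
  next
    case False
    have "integral {- N..t} g + integral {t..0} g = integral {- N..0} g"
      by (rule Henstock_Kurzweil_Integration.integral_combine) (use False that int in auto)
    moreover have "integral {0..t} g = 0" using False by simp
    ultimately show ?thesis by (simp add: G_def algebra_simps)
  qed
  have "(G has_vector_derivative g t) (at t)" for t
  proof -
    define N where "N = \<bar>t\<bar> + 1"
    have t: "t \<in> {- N<..<N}" by (auto simp: N_def)
    have "((\<lambda>u. integral {- N..u} g) has_vector_derivative g t) (at t within {- N..N})"
      by (rule integral_has_vector_derivative) (use assms continuous_on_subset t in auto)
    then have "((\<lambda>u. integral {- N..u} g - integral {- N..0} g) has_vector_derivative g t - 0)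
        (at t within {- N..N})"
      by (intro derivative_intros)
    then have "((\<lambda>u. integral {- N..u} g - integral {- N..0} g) has_vector_derivative g t) (at t)"
      using t at_within_Icc_at[of "- N" t N] by simp
    then show ?thesis
      by (rule has_vector_derivative_transform_within_open[where S = "{- N<..<N}"])
        (use t G_shift[of N] in \<open>auto simp: N_def\<close>)
  qed
  moreover have "G 0 = 0" by (simp add: G_def)
  ultimately show ?thesis by blast
qed

text \<open>Integrating \<open>a * exp (c * s)\<close> gains a factor \<open>1 / c\<close>. With
  \<open>c = 2 * K\<close> this turns a Lipschitz constant \<open>K\<close> into the contraction
  factor 1/2.\<close>

lemma exp_weight_bound_nonneg:
  fixes G :: "real \<Rightarrow> 'a::real_normed_vector"
  assumes "G 0 = 0" and G': "\<And>t. (G has_vector_derivative g t) (at t)"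
    and g: "\<And>t. norm (g t) \<le> a * exp (c * \<bar>t\<bar>)" and "0 \<le> a" "0 < c" "0 \<le> t"
  shows "norm (G t) \<le> a / c * exp (c * t)"
proof (cases "t = 0")
  case True
  then show ?thesis using assms by simp
next
  case False
  have "norm (G t - G 0) \<le> a / c * exp (c * t) - a / c * exp (c * 0)"
  proof (rule differentiable_bound_general[where f' = g and \<phi>' = "\<lambda>s. a * exp (c * s)"])
    show "0 < t" using False assms by simp
    show "continuous_on {0..t} G"
      by (meson G' continuous_at_imp_continuous_on has_vector_derivative_continuous)
    show "continuous_on {0..t} (\<lambda>t. a / c * exp (c * t))"
      by (intro continuous_intros)
    show "((\<lambda>t. a / c * exp (c * t)) has_vector_derivative a * exp (c * x)) (at x)" for x
      unfolding has_real_derivative_iff_has_vector_derivative[symmetric]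
      by (rule derivative_eq_intros refl)+ (use \<open>0 < c\<close> in simp)
    show "norm (g x) \<le> a * exp (c * x)" if "0 < x" for x
      using g[of x] that by simp
  qed (rule G')
  moreover have "0 \<le> a / c * exp (c * 0)" using assms by simp
  ultimately show ?thesis using assms(1) by simp
qed

lemma exp_weight_bound:
  fixes G :: "real \<Rightarrow> 'a::real_normed_vector"
  assumes "G 0 = 0" and G': "\<And>t. (G has_vector_derivative g t) (at t)"
    and g: "\<And>t. norm (g t) \<le> a * exp (c * \<bar>t\<bar>)" and "0 \<le> a" "0 < c"
  shows "norm (G t) \<le> a / c * exp (c * \<bar>t\<bar>)"
proof (cases "0 \<le> t")
  case True
  then show ?thesis using exp_weight_bound_nonneg[OF assms] by simp
next
  case False
  have "((\<lambda>t. G (- t)) has_vector_derivative - g (- s)) (at s)" for s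
    using vector_diff_chain_at[of uminus "-1" s G "g (- s)"] G'[of "- s"]
      has_vector_derivative_minus[OF has_vector_derivative_id, of "at s"]
    by (simp add: o_def)
  then have "norm (G (- (- t))) \<le> a / c * exp (c * (- t))"
    by (rule exp_weight_bound_nonneg[rotated, where t = "- t"])
       (use assms g False in \<open>auto simp: order_trans[OF g]\<close>)
  then show ?thesis using False by simp
qed

text \<open>Picard iteration, run once and for all on the whole line: writing \<open>x t = x0 + exp (2 K |t|) y t\<close>
  with \<open>y\<close> bounded continuous, the integral operator is a contraction with factor \<open>1/2\<close> in \<open>y\<close>.\<close>

lemma ode_global_existence:
  fixes F :: "real \<Rightarrow> 'a::banach \<Rightarrow> 'a"
  assumes cont: "continuous_on UNIV (\<lambda>(t, x). F t x)"
    and lip: "\<And>t x y. norm (F t x - F t y) \<le> K * norm (x - y)"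
    and bd: "\<And>t. norm (F t x0) \<le> M"
    and "0 < K"
  shows "\<exists>x. x 0 = x0 \<and> (\<forall>t. (x has_vector_derivative F t (x t)) (at t))"
proof -
  define c where "c = 2 * K"
  have "0 < c" using \<open>0 < K\<close> by (simp add: c_def)
  have "0 \<le> M" using bd[of 0] norm_ge_zero order_trans by blast
  define w where "w s = exp (c * \<bar>s\<bar>)" for s :: real
  have w1: "1 \<le> w s" for s using \<open>0 < c\<close> by (simp add: w_def)
  have w0: "0 < w s" for s by (simp add: w_def)
  have contw: "continuous_on UNIV w" unfolding w_def by (intro continuous_intros)
  define fld where "fld y s = F s (x0 + w s *\<^sub>R apply_bcontfun y s)"
    for y :: "real \<Rightarrow>\<^sub>C 'a" and s
  have cont_fld: "continuous_on UNIV (fld y)" for y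
  proof -
    have "continuous_on UNIV (\<lambda>s. (s, x0 + w s *\<^sub>R apply_bcontfun y s))"
      by (intro continuous_intros contw continuous_on_apply_bcontfun)
    from continuous_on_compose2[OF cont this] show ?thesis by (simp add: fld_def)
  qed
  have "\<forall>y. \<exists>G. G 0 = 0 \<and> (\<forall>t. (G has_vector_derivative fld y t) (at t))"
    using antiderivative_real[OF cont_fld] by blast
  then obtain G where G0: "G y 0 = 0" and G': "(G y has_vector_derivative fld y t) (at t)" for y t
    by metis
  have fld_diff: "norm (fld y s - fld z s) \<le> K * dist y z * exp (c * \<bar>s\<bar>)" for y z s
  proof -
    have "norm (fld y s - fld z s)
        \<le> K * norm (w s *\<^sub>R apply_bcontfun y s - w s *\<^sub>R apply_bcontfun z s)"
      using lip[of s "x0 + w s *\<^sub>R apply_bcontfun y s" "x0 + w s *\<^sub>R apply_bcontfun z s"]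
      by (simp add: fld_def)
    also have "\<dots> = K * (w s * dist (apply_bcontfun y s) (apply_bcontfun z s))"
      using w0[of s] by (simp add: dist_norm flip: scaleR_diff_right)
    also have "\<dots> \<le> K * (w s * dist y z)"
      using \<open>0 < K\<close> w0[of s] by (intro mult_left_mono dist_bounded) auto
    finally show ?thesis by (simp add: w_def mult_ac)
  qed
  \<comment> \<open>At \<open>y = 0\<close> the field is \<open>F s x0\<close>, which is where
    \<open>M\<close> enters; the weight is at least 1 and absorbs it.\<close>
  have fld_bound: "norm (fld y s) \<le> (M + K * dist y 0) * exp (c * \<bar>s\<bar>)" for y s
  proof -
    have "norm (fld y s) \<le> norm (fld 0 s) + norm (fld y s - fld 0 s)"
      by (metis norm_triangle_sub)
    moreover have "norm (fld 0 s) \<le> M" using bd by (simp add: fld_def)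
    moreover have "M * 1 \<le> M * exp (c * \<bar>s\<bar>)"
      using w1[of s] \<open>0 \<le> M\<close> by (intro mult_left_mono) (auto simp: w_def)
    ultimately show ?thesis using fld_diff[of y s 0] by (simp add: algebra_simps)
  qed
  \<comment> \<open>Dividing by the weight makes a fixed point satisfy
    \<open>w t *\<^sub>R y t = G y t\<close>, which is the integral equation;
    \<open>fld_bound\<close> keeps the quotient bounded, as \<open>Bcontfun\<close>
    requires.\<close>
  define T where "T y = Bcontfun (\<lambda>t. inverse (w t) *\<^sub>R G y t)" for y
  have T: "apply_bcontfun (T y) t = inverse (w t) *\<^sub>R G y t" for y t
  proof -
    have "(\<lambda>t. inverse (w t) *\<^sub>R G y t) \<in> bcontfun"
    proof (rule bcontfun_normI)
      have "continuous_on UNIV (G y)"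
        by (meson G' continuous_at_imp_continuous_on has_vector_derivative_continuous)
      then show "continuous_on UNIV (\<lambda>t. inverse (w t) *\<^sub>R G y t)"
        using w0 by (intro continuous_intros contw) (auto simp: less_le)
      have "norm (G y t) \<le> (M + K * dist y 0) / c * w t" for t
        unfolding w_def by (rule exp_weight_bound[OF G0 G' fld_bound])
          (use \<open>0 \<le> M\<close> \<open>0 < K\<close> \<open>0 < c\<close> in auto)
      then show "norm (inverse (w t) *\<^sub>R G y t) \<le> (M + K * dist y 0) / c" for t
        using w0[of t] by (simp add: field_simps)
    qed
    then show ?thesis by (simp add: T_def Bcontfun_inverse)
  qed
  have "dist (T y) (T z) \<le> 1/2 * dist y z" for y z
  proof (rule dist_bound)
    fix t
    have "norm (G y t - G z t) \<le> (K * dist y z) / c * exp (c * \<bar>t\<bar>)"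
      by (rule exp_weight_bound[where g = "\<lambda>t. fld y t - fld z t"])
        (use G0 fld_diff \<open>0 < K\<close> \<open>0 < c\<close> G' in \<open>auto intro!: derivative_intros\<close>)
    then have *: "norm (G y t - G z t) \<le> 1/2 * dist y z * w t"
      using \<open>0 < K\<close> by (simp add: c_def w_def)
    show "dist (apply_bcontfun (T y) t) (apply_bcontfun (T z) t) \<le> 1/2 * dist y z"
    proof -
      have "dist (apply_bcontfun (T y) t) (apply_bcontfun (T z) t) = norm (G y t - G z t) / w t"
        using w0[of t] unfolding T dist_norm scaleR_diff_right[symmetric]
        by (simp add: divide_inverse_commute)
      then show ?thesis using * w0[of t] by (simp add: pos_divide_le_eq)
    qed
  qed
  then obtain y where y: "T y = y"
    using banach_fix_type[of "1/2" T] by auto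
  define x where "x t = x0 + w t *\<^sub>R apply_bcontfun y t" for t
  have "x t = x0 + G y t" for t
  proof -
    have "apply_bcontfun y t = inverse (w t) *\<^sub>R G y t" using T[of y t] by (simp only: y)
    then show ?thesis using w0[of t] by (simp add: x_def)
  qed
  then have "x = (\<lambda>t. x0 + G y t)" by blast
  moreover have "((\<lambda>t. x0 + G y t) has_vector_derivative F t (x t)) (at t)" for t
    using G'[of y t] by (auto simp: fld_def x_def intro!: derivative_eq_intros)
  ultimately show ?thesis using G0 by (intro exI[of _ x]) simp
qed

text \<open>The integrating factor \<open>exp (- K * s)\<close> turns the differential inequality
  into monotonicity. Derivatives are taken within \<open>{0..1}\<close> because
  \<open>has_riem_exp\<close> uses geodesics on that interval.\<close>

lemma gronwall_zero:
  fixes e :: "real \<Rightarrow> real"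
  assumes "e 0 = 0"
    and e': "\<And>t. t \<in> {0..1} \<Longrightarrow> (e has_real_derivative e' t) (at t within {0..1})"
    and bd: "\<And>t. t \<in> {0..1} \<Longrightarrow> e' t \<le> K * e t"
    and "\<And>t. t \<in> {0..1} \<Longrightarrow> 0 \<le> e t"
    and t: "t \<in> {0..1}"
  shows "e t = 0"
proof -
  define h where "h s = exp (- K * s) * e s" for s
  have h': "(h has_real_derivative exp (- K * s) * (e' s - K * e s)) (at s within {0..1})"
    if "s \<in> {0..1}" for s
    unfolding h_def
    by (rule derivative_eq_intros e' that refl)+ (simp add: algebra_simps)
  have "h t \<le> h 0"
  proof (cases "t = 0")
    case False
    show ?thesis
    proof (rule DERIV_nonpos_imp_decreasing_open[where f = h and a = 0 and b = t])
      show "\<exists>y. (h has_real_derivative y) (at s) \<and> y \<le> 0" if "0 < s" "s < t" for s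
      proof -
        have "at s within {0..1} = at s"
          by (rule at_within_Icc_at) (use that t in auto)
        moreover have "exp (- K * s) * (e' s - K * e s) \<le> 0"
          using bd[of s] that t by (intro mult_nonneg_nonpos) auto
        ultimately show ?thesis using h'[of s] that t by auto
      qed
      have "continuous_on {0..1} h"
        by (rule DERIV_continuous_on) (rule h')
      then show "continuous_on {0..t} h"
        by (rule continuous_on_subset) (use t in auto)
    qed (use t in auto)
  qed simp
  then have "e t \<le> 0"
    using \<open>e 0 = 0\<close> by (simp add: h_def mult_le_0_iff)
  then show ?thesis using assms(4)[OF t] by simp
qed

subsection \<open>Linear algebra and matrix calculus\<close>

text \<open>The form is controlled only on \<open>V\<close>, so it is encoded in an endomorphism
  \<open>T\<close> of the whole space: the identity on the orthogonal complement of
  \<open>V\<close>, and on \<open>V\<close> the coordinates of \<open>g x\<close> in an orthonormal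
  basis. Positivity makes \<open>T\<close> injective, hence surjective by dimension.\<close>

lemma riesz_subspace:
  fixes g :: "'a::euclidean_space \<Rightarrow> 'a \<Rightarrow> real"
  assumes "subspace V"
    and addl: "\<And>x y z. x \<in> V \<Longrightarrow> y \<in> V \<Longrightarrow> z \<in> V \<Longrightarrow> g (x + y) z = g x z + g y z"
    and scl: "\<And>c x z. x \<in> V \<Longrightarrow> z \<in> V \<Longrightarrow> g (c *\<^sub>R x) z = c * g x z"
    and addr: "\<And>x y z. x \<in> V \<Longrightarrow> y \<in> V \<Longrightarrow> z \<in> V \<Longrightarrow> g z (x + y) = g z x + g z y"
    and scr: "\<And>c x z. x \<in> V \<Longrightarrow> z \<in> V \<Longrightarrow> g z (c *\<^sub>R x) = c * g z x"
    and pos: "\<And>x. x \<in> V \<Longrightarrow> x \<noteq> 0 \<Longrightarrow> 0 < g x x"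
    and phi_add: "\<And>x y. x \<in> V \<Longrightarrow> y \<in> V \<Longrightarrow> \<phi> (x + y) = \<phi> x + \<phi> y"
    and phi_sc: "\<And>c x. x \<in> V \<Longrightarrow> \<phi> (c *\<^sub>R x) = c * \<phi> x"
  shows "\<exists>w\<in>V. \<forall>z\<in>V. g w z = \<phi> z"
proof -
  obtain B where B: "B \<subseteq> V" "pairwise orthogonal B" "\<And>x. x \<in> B \<Longrightarrow> norm x = 1"
      "independent B" "span B = V"
    using orthonormal_basis_subspace[OF assms(1)] by metis
  have "finite B" using B(4) independent_imp_finite by blast
  define P where "P x = (\<Sum>b\<in>B. (x \<bullet> b) *\<^sub>R b)" for x
  have P_V: "P x \<in> V" for x
    unfolding P_def using B(1) by (auto intro!: subspace_sum subspace_scale assms(1))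
  have P_inner: "P x \<bullet> b = x \<bullet> b" if "b \<in> B" for x b
  proof -
    have "P x \<bullet> b = (\<Sum>b'\<in>B. (x \<bullet> b') * (b' \<bullet> b))" by (simp add: P_def inner_sum_left)
    also have "\<dots> = (\<Sum>b'\<in>B. if b' = b then x \<bullet> b else 0)"
    proof (rule sum.cong)
      fix b' assume b': "b' \<in> B"
      have "b \<bullet> b = 1" using B(3)[OF that] by (simp add: norm_eq_1)
      moreover have "b' \<bullet> b = 0" if "b' \<noteq> b"
        using B(2) b' \<open>b \<in> B\<close> that by (auto simp: pairwise_def orthogonal_def)
      ultimately show "(x \<bullet> b') * (b' \<bullet> b) = (if b' = b then x \<bullet> b else 0)" by auto
    qed simp
    also have "\<dots> = x \<bullet> b" using \<open>finite B\<close> that by simp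
    finally show ?thesis .
  qed
  have P_add: "P (x + y) = P x + P y" and P_sc: "P (c *\<^sub>R x) = c *\<^sub>R P x" for x y c
    by (simp_all add: P_def inner_left_distrib scaleR_left_distrib sum.distrib scaleR_sum_right)
  define N where "N x = (\<Sum>b\<in>B. g (P x) b *\<^sub>R b)" for x
  define T where "T x = (x - P x) + N x" for x
  have N_V: "N x \<in> V" for x
    unfolding N_def using B(1) by (auto intro!: subspace_sum subspace_scale assms(1))
  have N_add: "N (x + y) = N x + N y" and N_sc: "N (c *\<^sub>R x) = c *\<^sub>R N x" for x y c
    using B(1) by (auto simp: N_def P_add P_sc addl scl P_V scaleR_left_distrib subset_iff
        scaleR_sum_right simp flip: sum.distrib intro!: sum.cong)
  have "linear T"
    by (rule linearI) (simp_all add: T_def P_add P_sc N_add N_sc algebra_simps)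
  have indep: "(\<Sum>b\<in>B. r b *\<^sub>R b) = (\<Sum>b\<in>B. r' b *\<^sub>R b) \<Longrightarrow> b \<in> B \<Longrightarrow> r b = r' b" for r r' b
  proof -
    assume "(\<Sum>b\<in>B. r b *\<^sub>R b) = (\<Sum>b\<in>B. r' b *\<^sub>R b)" "b \<in> B"
    then have "(\<Sum>b\<in>B. (r b - r' b) *\<^sub>R b) = 0"
      by (simp add: scaleR_left_diff_distrib sum_subtractf)
    then show "r b = r' b"
      using independentD[OF B(4) \<open>finite B\<close> subset_refl, of "\<lambda>b. r b - r' b" b] \<open>b \<in> B\<close> by simp
  qed
  have on_basis: "\<psi> z = 0" if "z \<in> V" "\<And>b. b \<in> B \<Longrightarrow> \<psi> b = 0"
    "\<And>x y. x \<in> V \<Longrightarrow> y \<in> V \<Longrightarrow> \<psi> (x + y) = \<psi> x + \<psi> y"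
    "\<And>c x. x \<in> V \<Longrightarrow> \<psi> (c *\<^sub>R x) = c * \<psi> x" for \<psi> :: "'a \<Rightarrow> real" and z
  proof -
    have "z \<in> span B" using that B by simp
    then have "z \<in> V \<and> \<psi> z = 0"
    proof (induction rule: span_induct_alt)
      case base
      show ?case using that(4)[of 0 0] subspace_0[OF assms(1)] by simp
    next
      case (step c x y)
      then have "c *\<^sub>R x \<in> V" using B(1) subspace_scale[OF assms(1)] by blast
      then show ?case using step that B(1) subspace_add[OF assms(1)] by (auto simp: subset_iff)
    qed
    then show ?thesis by simp
  qed
  have proj_fix: "P x = x" if "x \<in> V" for x
  proof -
    have "x - P x \<in> V" using that P_V subspace_diff assms(1) by blast
    then have "(\<lambda>y. (x - P x) \<bullet> y) (x - P x) = 0"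
      by (rule on_basis) (auto simp: inner_diff_left P_inner inner_right_distrib)
    then show ?thesis by simp
  qed
  have "inj T"
  proof (rule linear_injective_0[THEN iffD2, OF \<open>linear T\<close>, rule_format])
    fix x assume "T x = 0"
    \<comment> \<open>The component off \<open>V\<close> equals an element of \<open>V\<close>; this
      puts \<open>x\<close> in \<open>V\<close>, where that component vanishes.\<close>
    then have *: "x - P x = - N x" by (simp add: T_def eq_neg_iff_add_eq_0)
    then have "x = P x - N x" by (simp add: algebra_simps)
    then have xV: "x \<in> V" using P_V N_V subspace_diff assms(1) by metis
    then have "N x = 0" using * proj_fix by simp
    then have "g x b = 0" if "b \<in> B" for b
      using indep[of "\<lambda>b. g (P x) b" "\<lambda>_. 0" b] that proj_fix[OF xV] by (simp add: N_def)
    then have "g x x = 0"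
      by (intro on_basis[OF xV, of "g x"]) (use xV addr scr in auto)
    then show "x = 0" using pos[OF xV] by force
  qed
  then have "surj T" using linear_injective_imp_surjective \<open>linear T\<close> by blast
  then obtain x where x: "T x = (\<Sum>b\<in>B. \<phi> b *\<^sub>R b)" by (metis surjD)
  have "x = (\<Sum>b\<in>B. \<phi> b *\<^sub>R b) + P x - N x" using x by (simp add: T_def algebra_simps)
  moreover have "(\<Sum>b\<in>B. \<phi> b *\<^sub>R b) \<in> V"
    using B(1) by (auto intro!: subspace_sum subspace_scale assms(1))
  ultimately have xV: "x \<in> V"
    using P_V N_V by (metis subspace_add subspace_diff assms(1))
  then have "g x b = \<phi> b" if "b \<in> B" for b
    using indep[of "\<lambda>b. g (P x) b" \<phi> b] that proj_fix[OF xV] x by (simp add: N_def T_def)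
  then have "g x z - \<phi> z = 0" if "z \<in> V" for z
    using on_basis[OF that, of "\<lambda>z. g x z - \<phi> z"] xV B(1)
    by (simp add: addr scr phi_add phi_sc algebra_simps)
  then show ?thesis using xV by auto
qed

text \<open>The projection onto a centered ball is radial. This is what keeps the truncated
  Euler-Arnold field tangent to the level sets of the energy.\<close>

lemma closest_point_cball_0:
  fixes x :: "'a::euclidean_space"
  assumes "0 < R"
  shows "\<exists>c. closest_point (cball 0 R) x = c *\<^sub>R x"
proof (cases "norm x \<le> R")
  case True
  then show ?thesis by (intro exI[of _ 1]) (simp add: closest_point_self)
next
  case False
  define y where "y = (R / norm x) *\<^sub>R x"
  have "y = closest_point (cball 0 R) x"
  proof (rule closest_point_unique)
    show "y \<in> cball 0 R" using assms False by (simp add: y_def)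
    have "x - y = (1 - R / norm x) *\<^sub>R x" by (simp add: y_def algebra_simps)
    then have "dist x y = \<bar>1 - R / norm x\<bar> * norm x" by (simp add: dist_norm)
    also have "1 - R / norm x \<ge> 0" using False assms by (auto simp: divide_le_eq)
    then have "\<bar>1 - R / norm x\<bar> * norm x = norm x - R" using False assms by (auto simp: field_simps)
    finally have eq: "dist x y = norm x - R" .
    show "\<forall>z\<in>cball 0 R. dist x y \<le> dist x z"
    proof
      fix z :: 'a assume "z \<in> cball 0 R"
      then show "dist x y \<le> dist x z"
        unfolding eq using norm_triangle_ineq2[of x z] by (simp add: dist_norm)
    qed
  qed auto
  then show ?thesis unfolding y_def by metis
qed

lemma bounded_bilinear_matmul:
  "bounded_bilinear ((**) :: real^'m^'n \<Rightarrow> real^'k^'m \<Rightarrow> real^'k^'n)"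
  unfolding bilinear_conv_bounded_bilinear[symmetric] bilinear_def
  by (auto simp: linear_iff vec_eq_iff matrix_matrix_mult_def sum.distrib algebra_simps
      sum_distrib_left)

lemma bounded_bilinear_matvec:
  "bounded_bilinear ((*v) :: real^'m^'n \<Rightarrow> real^'m \<Rightarrow> real^'n)"
  unfolding bilinear_conv_bounded_bilinear[symmetric] bilinear_def
  by (auto simp: linear_iff vec_eq_iff matrix_vector_mult_def sum.distrib algebra_simps
      sum_distrib_left)

interpretation mm: bounded_bilinear "(**) :: real^'m^'n \<Rightarrow> real^'k^'m \<Rightarrow> real^'k^'n"
  by (rule bounded_bilinear_matmul)

interpretation mv: bounded_bilinear "(*v) :: real^'m^'n \<Rightarrow> real^'m \<Rightarrow> real^'n"
  by (rule bounded_bilinear_matvec)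

lemma matrix_inv_right: "invertible (A :: real^'n^'n) \<Longrightarrow> A ** matrix_inv A = mat 1"
  and matrix_inv_left: "invertible (A :: real^'n^'n) \<Longrightarrow> matrix_inv A ** A = mat 1"
  unfolding matrix_inv_def invertible_def by (metis (mono_tags, lifting) someI_ex)+

lemma matrix_inv_right_mult: "invertible (A :: real^'n^'n) \<Longrightarrow> A ** (matrix_inv A ** M) = M"
  and matrix_inv_left_mult: "invertible (A :: real^'n^'n) \<Longrightarrow> matrix_inv A ** (A ** M) = M"
  by (simp_all add: matrix_mul_assoc matrix_inv_right matrix_inv_left)

lemma matrix_inv_unique:
  fixes A :: "real^'n^'n"
  assumes "A ** B = mat 1"
  shows "invertible A" "matrix_inv A = B"
proof -
  show inv: "invertible A"
    using assms matrix_left_right_inverse unfolding invertible_def by blast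
  have "matrix_inv A ** (A ** B) = B"
    using inv by (rule matrix_inv_left_mult)
  then show "matrix_inv A = B" by (simp add: assms)
qed

lemma matrix_inv_mult:
  fixes A B :: "real^'n^'n"
  assumes "invertible A" "invertible B"
  shows "invertible (A ** B)" "matrix_inv (A ** B) = matrix_inv B ** matrix_inv A"
proof -
  have "(A ** B) ** (matrix_inv B ** matrix_inv A) = mat 1"
    using assms by (simp add: matrix_mul_assoc[symmetric] matrix_inv_right_mult matrix_inv_right)
  then show "invertible (A ** B)" "matrix_inv (A ** B) = matrix_inv B ** matrix_inv A"
    using matrix_inv_unique by blast+
qed

lemma differentiable_prod_real:
  fixes f :: "'i \<Rightarrow> 'a::real_normed_vector \<Rightarrow> real"
  assumes "\<And>i. i \<in> I \<Longrightarrow> f i differentiable (at x within S)"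
  shows "(\<lambda>x. \<Prod>i\<in>I. f i x) differentiable (at x within S)"
  using assms by (induction I rule: infinite_finite_induct) auto

lemma differentiable_det:
  fixes A :: "'a::real_normed_vector \<Rightarrow> real^'n^'n"
  assumes "\<And>i j. (\<lambda>x. A x $ i $ j) differentiable (at x within S)"
  shows "(\<lambda>x. det (A x)) differentiable (at x within S)"
  unfolding det_def
  by (intro differentiable_sum differentiable_mult differentiable_prod_real differentiable_const
      assms finite_permutations ballI) simp

text \<open>Solving \<open>A *v x = axis j 1\<close> by Cramer's rule exhibits the entries of the
  inverse as quotients of determinants, from which differentiability can be read off.\<close>

lemma matrix_inv_cramer:
  fixes A :: "real^'n^'n"
  assumes "det A \<noteq> 0"
  shows "matrix_inv A =
    (\<chi> i j. det (\<chi> r c. if c = i then axis j 1 $ r else A $ r $ c) / det A)"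
proof -
  have inv: "invertible A" using assms invertible_det_nz by blast
  have "matrix_inv A $ i $ j = det (\<chi> r c. if c = i then axis j 1 $ r else A $ r $ c) / det A" for i j
  proof -
    have "A *v (matrix_inv A *v axis j 1) = axis j 1"
      by (simp add: matrix_vector_mul_assoc matrix_inv_right[OF inv])
    then have "matrix_inv A *v axis j 1
        = (\<chi> k. det (\<chi> r c. if c = k then axis j 1 $ r else A $ r $ c) / det A)"
      using cramer[OF assms] by blast
    then show ?thesis
      by (simp add: vec_eq_iff matrix_vector_mult_basis column_def)
  qed
  then show ?thesis by (simp add: vec_eq_iff)
qed

lemma differentiable_vec_lambda:
  fixes f :: "'i::finite \<Rightarrow> 'a::euclidean_space \<Rightarrow> 'b::euclidean_space"
  assumes "\<And>i. f i differentiable (at x within S)"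
  shows "(\<lambda>x. \<chi> i. f i x) differentiable (at x within S)"
  unfolding differentiable_componentwise_within[of "\<lambda>x. \<chi> i. f i x"]
  using assms differentiable_componentwise_within[of "f _"]
  by (auto simp: Basis_vec_def inner_axis)

text \<open>Cramer's rule gives only the existence of a derivative; its value then follows by
  differentiating \<open>M ** matrix_inv M = mat 1\<close>.\<close>

lemma has_derivative_matrix_inv_at:
  fixes A :: "real^'n^'n"
  assumes "invertible A"
  shows "(matrix_inv has_derivative (\<lambda>H. - (matrix_inv A ** H ** matrix_inv A))) (at A)"
proof -
  let ?U = "{M :: real^'n^'n. det M \<noteq> 0}"
  have "continuous_on UNIV (det :: real^'n^'n \<Rightarrow> real)"
    unfolding det_def by (intro continuous_intros)
  then have "open ((det :: real^'n^'n \<Rightarrow> real) -` (- {0}))"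
    by (rule open_vimage[rotated]) auto
  then have "open ?U" by (simp add: vimage_def)
  have AU: "A \<in> ?U" using assms invertible_det_nz by blast
  have entry: "(\<lambda>M :: real^'n^'n. M $ i $ j) differentiable (at A)" for i j
    by (intro linear_imp_differentiable linearI) auto
  have "(\<lambda>M. \<chi> i j. det (\<chi> r c. if c = i then axis j 1 $ r else M $ r $ c) / det M)
      differentiable (at A)"
  proof (intro differentiable_vec_lambda differentiable_divide differentiable_det entry)
    show "(\<lambda>M. (\<chi> r c. if c = i then axis j 1 $ r else M $ r $ c) $ r $ c) differentiable (at A)"
      for i j r c :: 'n
      by (cases "c = i") (simp_all add: entry)
    show "det A \<noteq> 0" using AU by simp
  qed
  then obtain D0 where "((\<lambda>M. \<chi> i j. det (\<chi> r c. if c = i then axis j 1 $ r else M $ r $ c) / det M)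
      has_derivative D0) (at A)"
    unfolding differentiable_def by blast
  then have D0: "(matrix_inv has_derivative D0) (at A)"
    by (rule has_derivative_transform_within_open[OF _ \<open>open ?U\<close> AU]) (simp add: matrix_inv_cramer)
  have "((\<lambda>M. M ** matrix_inv M) has_derivative (\<lambda>H. A ** D0 H + H ** matrix_inv A)) (at A)"
    by (rule mm.FDERIV[OF has_derivative_ident D0])
  moreover have "((\<lambda>M. M ** matrix_inv M) has_derivative (\<lambda>H. 0)) (at A)"
    by (rule has_derivative_transform_within_open[OF has_derivative_const[of "mat 1"] \<open>open ?U\<close> AU])
      (simp add: matrix_inv_right invertible_det_nz)
  ultimately have "(\<lambda>H. A ** D0 H + H ** matrix_inv A) = (\<lambda>H. 0)"
    by (rule has_derivative_unique)
  then have eq: "A ** D0 H = - (H ** matrix_inv A)" for H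
    by (metis eq_neg_iff_add_eq_0)
  have "D0 H = - (matrix_inv A ** H ** matrix_inv A)" for H
    using arg_cong[OF eq[of H], of "\<lambda>M. matrix_inv A ** M"]
    by (simp add: matrix_mul_assoc matrix_inv_left assms mm.minus_right)
  then have "D0 = (\<lambda>H. - (matrix_inv A ** H ** matrix_inv A))" by blast
  with D0 show ?thesis by simp
qed

lemma has_derivative_matrix_inv:
  fixes g :: "'a::real_normed_vector \<Rightarrow> real^'n^'n"
  assumes "(g has_derivative g') (at x within S)" "invertible (g x)"
  shows "((\<lambda>x. matrix_inv (g x)) has_derivative
    (\<lambda>h. - (matrix_inv (g x) ** g' h ** matrix_inv (g x)))) (at x within S)"
  using has_derivative_compose[OF assms(1) has_derivative_matrix_inv_at[OF assms(2)]] .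

lemma has_vector_derivative_matrix_inv:
  fixes g :: "real \<Rightarrow> real^'n^'n"
  assumes "(g has_vector_derivative g') (at x within S)" "invertible (g x)"
  shows "((\<lambda>x. matrix_inv (g x)) has_vector_derivative
    - (matrix_inv (g x) ** g' ** matrix_inv (g x))) (at x within S)"
  using has_derivative_matrix_inv[OF assms(1)[unfolded has_vector_derivative_def] assms(2)]
  unfolding has_vector_derivative_def
  by (simp add: mm.scaleR_left mm.scaleR_right)

lemma has_vector_derivative_matmul:
  fixes f :: "real \<Rightarrow> real^'m^'n" and g :: "real \<Rightarrow> real^'k^'m"
  assumes "(f has_vector_derivative f') (at t within S)" "(g has_vector_derivative g') (at t within S)"
  shows "((\<lambda>t. f t ** g t) has_vector_derivative f t ** g' + f' ** g t) (at t within S)"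
  by (rule mm.has_vector_derivative[OF assms])

lemma differentiable_matrix_inv:
  fixes g :: "'a::real_normed_vector \<Rightarrow> real^'n^'n"
  assumes "g differentiable (at x within S)" "invertible (g x)"
  shows "(\<lambda>x. matrix_inv (g x)) differentiable (at x within S)"
  using assms has_derivative_matrix_inv unfolding differentiable_def by blast

lemma differentiable_bilinear:
  assumes "bounded_bilinear h" "f differentiable (at x within S)" "g differentiable (at x within S)"
  shows "(\<lambda>x. h (f x) (g x)) differentiable (at x within S)"
  using assms bounded_bilinear.FDERIV unfolding differentiable_def by blast

subsection \<open>Triangular and diagonal matrices\<close>

text \<open>A linear parametrization of the diagonal matrices, the Lie algebra of the acting group;
  the vertical vectors at \<open>L\<close> become \<open>dg d ** L\<close>.\<close>

definition dg :: "real^'n \<Rightarrow> 'n::finite sqmat" where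
  "dg d = (\<chi> i j. if i = j then d $ i else 0)"

lemma dg_mult_nth: "(dg d ** M) $ i $ j = d $ i * M $ i $ j"
proof -
  have "(dg d ** M) $ i $ j = (\<Sum>k\<in>UNIV. if i = k then d $ i * M $ k $ j else 0)"
    unfolding matrix_matrix_mult_def dg_def by (simp add: if_distrib if_distribR cong: if_cong)
  then show ?thesis by simp
qed

lemma dg_mult_dg: "dg d ** dg e = dg (\<chi> i. d $ i * e $ i)"
  by (simp add: vec_eq_iff dg_mult_nth) (simp add: dg_def)

lemma dg_commute: "dg d ** dg e = dg e ** dg d"
  by (simp add: dg_mult_dg mult.commute)

lemma linear_dg: "linear dg"
  by (rule linearI) (auto simp: dg_def vec_eq_iff)

lemma Diag_eq_dg: "Diag M = dg (\<chi> i. M $ i $ i)"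
  by (simp add: Diag_def dg_def vec_eq_iff)

lemma Diag_nth: "Diag M $ i $ j = (if i = j then M $ i $ i else 0)"
  by (simp add: Diag_def)

lemma linear_Diag: "linear Diag"
  by (rule linearI) (auto simp: Diag_def vec_eq_iff)

lemma bounded_linear_Diag: "bounded_linear Diag"
  using linear_Diag linear_conv_bounded_linear by blast

lemma Diag_dg_mult: "Diag (dg d ** M) = dg d ** Diag M"
  by (auto simp: vec_eq_iff dg_mult_nth Diag_nth)

lemma dg_inv:
  assumes "\<And>i. d $ i \<noteq> 0"
  shows "invertible (dg d)" "matrix_inv (dg d) = dg (\<chi> i. 1 / d $ i)"
proof -
  have "dg d ** dg (\<chi> i. 1 / d $ i) = mat 1"
    using assms by (simp add: dg_mult_dg) (simp add: dg_def mat_def vec_eq_iff)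
  then show "invertible (dg d)" "matrix_inv (dg d) = dg (\<chi> i. 1 / d $ i)"
    by (rule matrix_inv_unique)+
qed

lemma subspace_LTri: "subspace LTri" and subspace_LT0: "subspace LT0"
  by (auto simp: subspace_def LTri_def LT0_def)

lemma LT1_LTri: "p \<in> LT1 \<Longrightarrow> p \<in> LTri" and LT1_LTpos: "p \<in> LT1 \<Longrightarrow> p \<in> LTpos"
  and LT0_LTri: "v \<in> LT0 \<Longrightarrow> v \<in> LTri" and LTpos_LTri: "p \<in> LTpos \<Longrightarrow> p \<in> LTri"
  by (auto simp: LT0_def LT1_def LTpos_def)

lemma dg_LTri: "dg d \<in> LTri"
  by (auto simp: dg_def LTri_def)

lemma LTri_mult:
  assumes "A \<in> LTri" "B \<in> LTri"
  shows "A ** B \<in> LTri"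
proof -
  have "(\<Sum>k\<in>UNIV. A $ i $ k * B $ k $ j) = 0" if "i < j" for i j
  proof (rule sum.neutral, rule ballI)
    fix k
    show "A $ i $ k * B $ k $ j = 0"
      using assms that by (cases "i < k") (auto simp: LTri_def)
  qed
  then show ?thesis by (simp add: LTri_def matrix_matrix_mult_def)
qed

lemma LTri_mult_diag:
  assumes "A \<in> LTri" "B \<in> LTri"
  shows "(A ** B) $ i $ i = A $ i $ i * B $ i $ i"
proof -
  have "(\<Sum>k\<in>UNIV. A $ i $ k * B $ k $ i) = (\<Sum>k\<in>UNIV. if k = i then A $ i $ i * B $ i $ i else 0)"
  proof (rule sum.cong)
    fix k
    show "A $ i $ k * B $ k $ i = (if k = i then A $ i $ i * B $ i $ i else 0)"
      using assms by (cases i k rule: linorder_cases) (auto simp: LTri_def)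
  qed simp
  then show ?thesis by (simp add: matrix_matrix_mult_def)
qed

text \<open>Only the rows up to \<open>j\<close> are assumed to vanish. With all rows this gives
  injectivity; with the rows above a unit entry it gives the triangular shape of the
  inverse.\<close>

lemma LTri_forward_substitution:
  fixes A :: "'n::{finite,linorder} sqmat"
  assumes A: "A \<in> LTri" "\<And>i. A $ i $ i \<noteq> 0" and 0: "\<And>i. i \<le> j \<Longrightarrow> (A *v x) $ i = 0"
  shows "x $ j = 0"
proof (rule ccontr)
  assume "x $ j \<noteq> 0"
  define I where "I = {i. i \<le> j \<and> x $ i \<noteq> 0}"
  have "finite I" "I \<noteq> {}" using \<open>x $ j \<noteq> 0\<close> by (auto simp: I_def)
  define m where "m = Min I"
  have m: "m \<le> j" "x $ m \<noteq> 0" using Min_in[OF \<open>finite I\<close> \<open>I \<noteq> {}\<close>] by (auto simp: I_def m_def)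
  have min: "x $ k = 0" if "k < m" for k
  proof (rule ccontr)
    assume "x $ k \<noteq> 0"
    then have "k \<in> I" using that m(1) by (simp add: I_def)
    then have "m \<le> k" unfolding m_def by (rule Min_le[OF \<open>finite I\<close>])
    with that show False by simp
  qed
  have "(A *v x) $ m = (\<Sum>k\<in>UNIV. if k = m then A $ m $ m * x $ m else 0)"
    unfolding matrix_vector_mult_def vec_lambda_beta
  proof (rule sum.cong)
    fix k
    show "A $ m $ k * x $ k = (if k = m then A $ m $ m * x $ m else 0)"
      using A(1) min by (cases m k rule: linorder_cases) (auto simp: LTri_def)
  qed simp
  then show False using 0[OF m(1)] m(2) A(2) by simp
qed

lemma LTri_invertible:
  fixes A :: "'n::{finite,linorder} sqmat"
  assumes A: "A \<in> LTri" "\<And>i. A $ i $ i \<noteq> 0"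
  shows "invertible A" and "matrix_inv A \<in> LTri"
proof -
  have "x = 0" if "A *v x = 0" for x
    using LTri_forward_substitution[OF A, of _ x] that by (simp add: vec_eq_iff)
  then have "\<exists>B. B ** A = mat 1" using matrix_left_invertible_ker by blast
  then show inv: "invertible A"
    using matrix_left_right_inverse unfolding invertible_def by blast
  have "matrix_inv A $ i $ j = 0" if "i < j" for i j
  proof -
    have "A *v (matrix_inv A *v axis j 1) = axis j 1"
      by (simp add: matrix_vector_mul_assoc matrix_inv_right[OF inv])
    then have "(A *v (matrix_inv A *v axis j 1)) $ k = 0" if "k \<le> i" for k
      using that \<open>i < j\<close> by (auto simp: axis_def)
    then have "(matrix_inv A *v axis j 1) $ i = 0"
      by (rule LTri_forward_substitution[OF A])
    then show ?thesis by (simp add: matrix_vector_mult_basis column_def)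
  qed
  then show "matrix_inv A \<in> LTri" by (simp add: LTri_def)
qed

lemma LTpos_invertible: "L \<in> LTpos \<Longrightarrow> invertible L"
  and LTpos_inv_LTri: "L \<in> LTpos \<Longrightarrow> matrix_inv L \<in> LTri"
  using LTri_invertible[of L] unfolding LTpos_def by (metis (mono_tags, lifting) mem_Collect_eq less_irrefl)+

lemma Diag_invertible: "L \<in> LTpos \<Longrightarrow> invertible (Diag L)"
  and matrix_inv_Diag: "L \<in> LTpos \<Longrightarrow> matrix_inv (Diag L) = dg (\<chi> i. 1 / L $ i $ i)"
  using dg_inv[of "\<chi> i. L $ i $ i"] by (auto simp: Diag_eq_dg LTpos_def less_le)

lemma lt_proj_nth: "L \<in> LTpos \<Longrightarrow> lt_proj L $ i $ j = L $ i $ j / L $ i $ i"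
  by (simp add: lt_proj_def matrix_inv_Diag dg_mult_nth)

lemma lt_proj_LT1: "L \<in> LTpos \<Longrightarrow> lt_proj L \<in> LT1"
  by (auto simp: LT1_def LTri_def lt_proj_nth) (auto simp: LTpos_def LTri_def less_le)

lemma Diag_mult_lt_proj: "L \<in> LTpos \<Longrightarrow> Diag L ** lt_proj L = L"
  by (simp add: lt_proj_def matrix_inv_right_mult Diag_invertible)

lemma lt_proj_LT1_id: "p \<in> LT1 \<Longrightarrow> lt_proj p = p"
  by (simp add: vec_eq_iff lt_proj_nth LT1_LTpos) (simp add: LT1_def)

lemma has_derivative_lt_proj:
  assumes "L \<in> LTpos"
  shows "(lt_proj has_derivative (\<lambda>Z. matrix_inv (Diag L) ** (Z - Diag Z ** lt_proj L))) (at L)"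
proof -
  have "(Diag has_derivative Diag) (at L)"
    by (rule bounded_linear_imp_has_derivative[OF bounded_linear_Diag])
  from mm.FDERIV[OF has_derivative_matrix_inv[OF this Diag_invertible[OF assms]] has_derivative_ident]
  show ?thesis
    unfolding lt_proj_def
    by (rule has_derivative_eq_rhs)
      (simp add: fun_eq_iff mm.diff_right mm.minus_left matrix_mul_assoc)
qed

lemma d_proj_eq: "L \<in> LTpos \<Longrightarrow> d_proj L Z = matrix_inv (Diag L) ** (Z - Diag Z ** lt_proj L)"
  unfolding d_proj_def by (simp add: frechet_derivative_at[OF has_derivative_lt_proj, symmetric])

lemma linear_d_proj: "L \<in> LTpos \<Longrightarrow> linear (d_proj L)"
  unfolding d_proj_def frechet_derivative_at[OF has_derivative_lt_proj, symmetric]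
  by (rule has_derivative_linear[OF has_derivative_lt_proj])

text \<open>The kernel equation reads \<open>Z = Diag Z ** matrix_inv (Diag L) ** L\<close>, so
  vertical vectors are the velocities of the orbits of the diagonal group.\<close>

lemma d_proj_zero_iff:
  assumes "L \<in> LTpos"
  shows "d_proj L Z = 0 \<longleftrightarrow> (\<exists>d. Z = dg d ** L)"
proof
  assume "d_proj L Z = 0"
  then have "Diag L ** (matrix_inv (Diag L) ** (Z - Diag Z ** lt_proj L)) = 0"
    by (simp add: d_proj_eq assms mm.zero_right)
  then have "Z = Diag Z ** lt_proj L"
    by (simp add: matrix_inv_right_mult Diag_invertible assms)
  then have "Z = (Diag Z ** matrix_inv (Diag L)) ** L"
    by (simp add: lt_proj_def matrix_mul_assoc)
  then show "\<exists>d. Z = dg d ** L"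
    by (metis Diag_eq_dg matrix_inv_Diag[OF assms] dg_mult_dg)
next
  assume "\<exists>d. Z = dg d ** L"
  then obtain d where Z: "Z = dg d ** L" ..
  have "Diag Z ** lt_proj L = dg d ** (Diag L ** lt_proj L)"
    by (simp add: Z Diag_dg_mult matrix_mul_assoc)
  then show "d_proj L Z = 0"
    by (simp add: d_proj_eq assms Diag_mult_lt_proj Z mm.zero_right)
qed

lemma vertical_eq: "L \<in> LTpos \<Longrightarrow> vertical L = range (\<lambda>d. dg d ** L)"
  unfolding vertical_def by (auto simp: d_proj_zero_iff LTpos_LTri intro!: LTri_mult dg_LTri)

text \<open>\<open>is_geodesic\<close> does not require its velocity field to be tangent. Tangency
  is recovered here: affine constraints on single entries pass from a curve to its
  derivative.\<close>

lemma has_vector_derivative_const_entry: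
  fixes x :: "real \<Rightarrow> 'n::{finite,linorder} sqmat"
  assumes x: "\<And>t. t \<in> I \<Longrightarrow> x t $ i $ j = c" and t: "t \<in> I"
    and "(x has_vector_derivative x') (at t within I)" and "at t within I \<noteq> bot"
  shows "x' $ i $ j = 0"
proof -
  have bl: "bounded_linear (\<lambda>M :: 'n sqmat. M $ i $ j)"
    unfolding linear_conv_bounded_linear[symmetric] by (rule linearI) auto
  have "((\<lambda>t. x t $ i $ j) has_vector_derivative x' $ i $ j) (at t within I)"
    by (rule bounded_linear.has_vector_derivative[OF bl assms(3)])
  moreover have "((\<lambda>t. x t $ i $ j) has_vector_derivative 0) (at t within I)"
    by (rule has_vector_derivative_transform[OF t _ has_vector_derivative_const[of c]]) (use x in auto)
  ultimately show ?thesis using assms(4) vector_derivative_unique_within by blast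
qed

subsection \<open>Geodesic equation and Euler-Arnold flow\<close>

lemma gronwall_vec:
  fixes e :: "real \<Rightarrow> 'a::real_inner"
  assumes "e 0 = 0"
    and e': "\<And>t. t \<in> {0..1} \<Longrightarrow> (e has_vector_derivative e' t) (at t within {0..1})"
    and bd: "\<And>t. t \<in> {0..1} \<Longrightarrow> norm (e' t) \<le> K * norm (e t)"
    and t: "t \<in> {0..1}"
  shows "e t = 0"
proof -
  have "e t \<bullet> e t = 0"
  proof (rule gronwall_zero[where e = "\<lambda>t. e t \<bullet> e t" and e' = "\<lambda>t. 2 * (e t \<bullet> e' t)"
        and K = "2 * K"])
    show "((\<lambda>t. e t \<bullet> e t) has_real_derivative 2 * (e s \<bullet> e' s)) (at s within {0..1})"
      if "s \<in> {0..1}" for s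
      unfolding has_real_derivative_iff_has_vector_derivative
      using bounded_bilinear.has_vector_derivative[OF bounded_bilinear_inner e'[OF that] e'[OF that]]
      by (simp add: inner_commute)
    show "2 * (e s \<bullet> e' s) \<le> 2 * K * (e s \<bullet> e s)" if "s \<in> {0..1}" for s
    proof -
      have "e s \<bullet> e' s \<le> norm (e s) * norm (e' s)" by (rule norm_cauchy_schwarz)
      also have "\<dots> \<le> norm (e s) * (K * norm (e s))"
        by (intro mult_left_mono bd that) simp
      finally show ?thesis by (simp add: dot_square_norm power2_eq_square algebra_simps)
    qed
  qed (use assms in auto)
  then show ?thesis by simp
qed

text \<open>The geodesic equation in weak form. Here \<open>h q v z\<close> is any smooth extension of \<open>g q v z\<close>, and along a
  curve with velocity \<open>u\<close> and acceleration \<open>a\<close> the right-hand side is the Euler-Lagrange equation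
  \<open>d/dt g(\<gamma>', z) = 1/2 \<partial>\<^sub>z g(\<gamma>', \<gamma>')\<close>.\<close>

lemma christoffel_iff:
  fixes V :: "'a::euclidean_space set" and h :: "'a \<Rightarrow> 'a \<Rightarrow> 'a \<Rightarrow> real"
  assumes V: "subspace V" and u: "u \<in> V" and a: "a \<in> V"
    and b: "bilinear b" and b_pos: "\<And>x. x \<in> V \<Longrightarrow> x \<noteq> 0 \<Longrightarrow> 0 < b x x"
    and gb: "\<And>x y. x \<in> V \<Longrightarrow> y \<in> V \<Longrightarrow> g p x y = b x y"
    and gh: "\<And>x y z. x \<in> V \<Longrightarrow> y \<in> V \<Longrightarrow> z \<in> V \<Longrightarrow>
      \<forall>\<^sub>F s in nhds 0. g (p + s *\<^sub>R z) x y = h (p + s *\<^sub>R z) x y"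
    and h_lin: "\<And>q v. linear (h q v)"
    and D: "\<And>z. z \<in> V \<Longrightarrow> ((\<lambda>(q, v). h q v z) has_derivative D z) (at (p, u))"
  shows "a = - christoffel V g p u u \<longleftrightarrow> (\<forall>z\<in>V. 2 * D z (u, a) = D u (z, 0))"
proof -
  have hp: "h p x y = b x y" if "x \<in> V" "y \<in> V" for x y
    using eventually_nhds_x_imp_x[OF gh[OF that V[THEN subspace_0]]] gb[OF that] by simp
  have D_lin: "linear (D z)" if "z \<in> V" for z
    using D[OF that] by (rule has_derivative_linear)
  have line: "((\<lambda>s. h (p + s *\<^sub>R x) (u + s *\<^sub>R y) z) has_real_derivative D z (x, y)) (at 0)"
    if "z \<in> V" for x y z
  proof -
    have "((\<lambda>s::real. (p + s *\<^sub>R x, u + s *\<^sub>R y)) has_vector_derivative (x, y)) (at 0)"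
      by (auto intro!: derivative_eq_intros has_vector_derivative_Pair)
    moreover have "((\<lambda>(q, v). h q v z) has_derivative D z)
        (at (p + 0 *\<^sub>R x, u + 0 *\<^sub>R y) within range (\<lambda>s::real. (p + s *\<^sub>R x, u + s *\<^sub>R y)))"
      using has_derivative_at_withinI[OF D[OF that]] by simp
    ultimately show ?thesis
      using vector_derivative_diff_chain_within[of "\<lambda>s::real. (p + s *\<^sub>R x, u + s *\<^sub>R y)" "(x, y)" 0 UNIV]
      unfolding has_real_derivative_iff_has_vector_derivative by (fastforce simp: o_def)
  qed
  have dd: "dir_deriv (\<lambda>q. g q u z) p x = D z (x, 0)" if "x \<in> V" "z \<in> V" for x z
    unfolding dir_deriv_def
  proof (rule DERIV_imp_deriv)
    show "((\<lambda>s. g (p + s *\<^sub>R x) u z) has_real_derivative D z (x, 0)) (at 0)"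
      using line[OF that(2), of x 0] DERIV_cong_ev[OF refl gh[OF u that(2,1)] refl] by simp
  qed
  \<comment> \<open>At \<open>p\<close> the extension agrees on \<open>V\<close> with
    \<open>b\<close>, which is linear in the velocity, so the velocity part of the derivative is
    \<open>b\<close> itself.\<close>
  have D_snd: "D z (0, a) = b a z" if "z \<in> V" for z
  proof -
    have "((\<lambda>s. b (u + s *\<^sub>R a) z) has_real_derivative b a z) (at 0)"
      using b unfolding bilinear_def linear_iff
      by (auto intro!: derivative_eq_intros)
    moreover have "h p (u + s *\<^sub>R a) z = b (u + s *\<^sub>R a) z" for s
      by (intro hp that subspace_add[OF V] subspace_scale[OF V] u a)
    ultimately show ?thesis using line[OF that, of 0 a] DERIV_unique by fastforce
  qed
  have D_split: "D z (u, a) = D z (u, 0) + b a z" if "z \<in> V" for z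
    using linear_add[OF D_lin[OF that], of "(u, 0)" "(0, a)"] D_snd[OF that] by simp
  \<comment> \<open>The derivatives \<open>D z\<close> are given separately for each
    \<open>z\<close>; their additivity in \<open>z\<close> comes from the linearity of
    \<open>h\<close> in the test vector.\<close>
  have D_add: "D (x + y) (u, 0) = D x (u, 0) + D y (u, 0)" if "x \<in> V" "y \<in> V" for x y
  proof -
    have "((\<lambda>s. h (p + s *\<^sub>R u) (u + s *\<^sub>R 0) x + h (p + s *\<^sub>R u) (u + s *\<^sub>R 0) y)
        has_real_derivative D x (u, 0) + D y (u, 0)) (at 0)"
      by (intro derivative_intros line that)
    then show ?thesis
      using line[OF subspace_add[OF V that], of u 0] linear_add[OF h_lin] DERIV_unique by fastforce
  qed
  have D_scale: "D (c *\<^sub>R x) (u, 0) = c * D x (u, 0)" if "x \<in> V" for x c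
  proof -
    have "((\<lambda>s. c * h (p + s *\<^sub>R u) (u + s *\<^sub>R 0) x) has_real_derivative c * D x (u, 0)) (at 0)"
      by (intro DERIV_cmult line that)
    then show ?thesis
      using line[OF subspace_scale[OF V that], of u 0 c] linear_scale[OF h_lin] DERIV_unique
      by fastforce
  qed
  \<comment> \<open>Half of the right-hand side of Koszul's formula with both arguments
    \<open>u\<close>; the Christoffel vector is its Riesz representative.\<close>
  define \<phi> where "\<phi> z = D z (u, 0) - D u (z, 0) / 2" for z
  have "\<exists>w\<in>V. \<forall>z\<in>V. b w z = \<phi> z"
  proof (rule riesz_subspace[OF V])
    show "\<phi> (x + y) = \<phi> x + \<phi> y" if "x \<in> V" "y \<in> V" for x y
      using linear_add[OF D_lin[OF u], of "(x, 0)" "(y, 0)"] D_add[OF that]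
      by (simp add: \<phi>_def field_simps)
    show "\<phi> (c *\<^sub>R x) = c * \<phi> x" if "x \<in> V" for x c
      using linear_scale[OF D_lin[OF u], of c "(x, 0)"] D_scale[OF that]
      by (simp add: \<phi>_def field_simps)
  qed (use b b_pos in \<open>auto simp: bilinear_def linear_iff\<close>)
  then obtain w where w: "w \<in> V" "\<And>z. z \<in> V \<Longrightarrow> b w z = \<phi> z" by blast
  have w_unique: "w' = w" if "w' \<in> V" "\<And>z. z \<in> V \<Longrightarrow> b w' z = \<phi> z" for w'
  proof (rule ccontr)
    assume "w' \<noteq> w"
    moreover have "w' - w \<in> V" using that w subspace_diff[OF V] by blast
    moreover have "b (w' - w) (w' - w) = 0"
      using that(2) w(2) calculation by (simp add: bilinear_lsub[OF b])
    ultimately show False using b_pos by fastforce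
  qed
  have "christoffel V g p u u = w"
    unfolding christoffel_def
  proof (rule the_equality)
    show "w \<in> V \<and> (\<forall>z\<in>V. 2 * g p w z = dir_deriv (\<lambda>q. g q u z) p u
        + dir_deriv (\<lambda>q. g q u z) p u - dir_deriv (\<lambda>q. g q u u) p z)"
      using w by (simp add: gb dd u \<phi>_def)
    show "w' = w" if "w' \<in> V \<and> (\<forall>z\<in>V. 2 * g p w' z = dir_deriv (\<lambda>q. g q u z) p u
        + dir_deriv (\<lambda>q. g q u z) p u - dir_deriv (\<lambda>q. g q u u) p z)" for w'
      by (rule w_unique) (use that in \<open>auto simp: gb dd u \<phi>_def\<close>)
  qed
  moreover have "a = - w \<longleftrightarrow> (\<forall>z\<in>V. 2 * D z (u, a) = D u (z, 0))"
  proof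
    assume "a = - w"
    then have "b a z = - \<phi> z" if "z \<in> V" for z
      using w(2)[OF that] by (simp add: bilinear_lneg[OF b])
    then show "\<forall>z\<in>V. 2 * D z (u, a) = D u (z, 0)"
      unfolding \<phi>_def by (auto simp: D_split)
  next
    assume *: "\<forall>z\<in>V. 2 * D z (u, a) = D u (z, 0)"
    have "- a = w"
      by (rule w_unique)
        (use * D_split a V in \<open>auto simp: bilinear_lneg[OF b] \<phi>_def subspace_neg field_simps\<close>)
    then show "a = - w" by auto
  qed
  ultimately show ?thesis by simp
qed

definition low :: "'n::{finite,linorder} sqmat \<Rightarrow> 'n sqmat" where
  "low M = (\<chi> i j. if i < j then 0 else M $ i $ j)"

lemma low_LTri: "low M \<in> LTri" and low_id: "M \<in> LTri \<Longrightarrow> low M = M"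
  by (auto simp: low_def LTri_def vec_eq_iff)

lemma linear_low: "linear low"
  by (rule linearI) (auto simp: low_def vec_eq_iff)

lemma lt_inner_sum:
  "lt_inner Z W = (\<Sum>i\<in>UNIV. \<Sum>j\<in>UNIV. Z $ i $ j * W $ i $ j) + (\<Sum>i\<in>UNIV. Z $ i $ i * W $ i $ i)"
proof -
  have "trace (Diag Z ** Diag W) = (\<Sum>i\<in>UNIV. Z $ i $ i * W $ i $ i)"
    unfolding Diag_eq_dg dg_mult_dg by (simp add: trace_def dg_def)
  moreover have "trace (Z ** transpose W) = (\<Sum>i\<in>UNIV. \<Sum>j\<in>UNIV. Z $ i $ j * W $ i $ j)"
    by (simp add: trace_def matrix_matrix_mult_def transpose_def)
  ultimately show ?thesis by (simp add: lt_inner_def)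
qed

lemma lt_inner_commute: "lt_inner Z W = lt_inner W Z"
  by (simp add: lt_inner_sum mult.commute)

lemma bilinear_lt_inner: "bilinear lt_inner"
  unfolding bilinear_def linear_iff
  by (auto simp: lt_inner_sum sum.distrib algebra_simps sum_distrib_left)

lemma has_vector_derivative_stays_LTri:
  fixes x :: "real \<Rightarrow> 'n::{finite,linorder} sqmat"
  assumes x': "\<And>t. (x has_vector_derivative x' t) (at t)" and "\<And>t. x' t \<in> LTri" and "x 0 \<in> LTri"
  shows "x t \<in> LTri"
proof -
  have "x t $ i $ j = 0" if "i < j" for i j
  proof -
    have bl: "bounded_linear (\<lambda>M :: 'n sqmat. M $ i $ j)"
      unfolding linear_conv_bounded_linear[symmetric] by (rule linearI) auto
    have d: "((\<lambda>t. x t $ i $ j) has_vector_derivative x' s $ i $ j) (at s)" for s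
      by (rule bounded_linear.has_vector_derivative[OF bl x'])
    have "((\<lambda>t. x t $ i $ j) has_real_derivative 0) (at s)" for s
    proof -
      have "x' s $ i $ j = 0" using assms(2)[of s] that by (simp add: LTri_def)
      with d[of s] show ?thesis
        by (simp add: has_real_derivative_iff_has_vector_derivative)
    qed
    then have "x t $ i $ j = x 0 $ i $ j"
      using DERIV_isconst_all by blast
    then show ?thesis using assms(3) that by (simp add: LTri_def)
  qed
  then show ?thesis by (simp add: LTri_def)
qed

section \<open>The Euler-Arnold field and its global flow\<close>

locale lie_cholesky =
  fixes f :: "'n::{finite,linorder} sqmat \<Rightarrow> 'n sqmat"
  assumes f_LT: "\<forall>Z\<in>LTri. f Z \<in> LTri"
    and f_add: "\<forall>Z\<in>LTri. \<forall>W\<in>LTri. f (Z + W) = f Z + f W"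
    and f_scale: "\<forall>c::real. \<forall>Z\<in>LTri. f (c *\<^sub>R Z) = c *\<^sub>R f Z"
    and f_self_adjoint: "\<forall>Z\<in>LTri. \<forall>W\<in>LTri. lt_inner (f Z) W = lt_inner Z (f W)"
    and f_pos_def: "\<forall>Z\<in>LTri. Z \<noteq> 0 \<longrightarrow> lt_inner (f Z) Z > 0"
begin

text \<open>Composing with \<^term>\<open>low\<close> makes the form bilinear on all matrices, since \<open>f\<close> is arbitrary
  off \<^term>\<open>LTri\<close>.\<close>

definition Q :: "'n sqmat \<Rightarrow> 'n sqmat \<Rightarrow> real" where
  "Q x y = lt_inner (f (low x)) (low y)"

lemma bounded_bilinear_Q: "bounded_bilinear Q"
proof -
  have "bilinear Q"
    unfolding bilinear_def linear_iff Q_def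
    using f_add f_scale
    by (simp add: low_LTri linear_add[OF linear_low] linear_scale[OF linear_low]
      bilinear_ladd[OF bilinear_lt_inner] bilinear_radd[OF bilinear_lt_inner]
      bilinear_lmul[OF bilinear_lt_inner] bilinear_rmul[OF bilinear_lt_inner])
  then show ?thesis by (simp add: bilinear_conv_bounded_bilinear)
qed

sublocale Q: bounded_bilinear Q
  by (rule bounded_bilinear_Q)

lemma Q_sym: "Q x y = Q y x"
  unfolding Q_def using f_self_adjoint low_LTri lt_inner_commute by metis

lemma Q_pos: "x \<in> LTri \<Longrightarrow> x \<noteq> 0 \<Longrightarrow> 0 < Q x x"
  unfolding Q_def using f_pos_def by (simp add: low_id)

lemma Q_eq: "x \<in> LTri \<Longrightarrow> y \<in> LTri \<Longrightarrow> Q x y = lt_inner (f x) y"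
  by (simp add: Q_def low_id)

text \<open>The constant is the minimum of \<open>Q x x\<close> on the compact unit sphere of
  \<open>LTri\<close>. It converts conservation of energy into a bound on the norm.\<close>

lemma Q_coercive: "\<exists>c>0. \<forall>x\<in>LTri. c * (norm x)\<^sup>2 \<le> Q x x"
proof (cases "sphere 0 1 \<inter> LTri = ({} :: 'n sqmat set)")
  case True
  have "x = 0" if "x \<in> LTri" for x :: "'n sqmat"
  proof (rule ccontr)
    assume "x \<noteq> 0"
    then have "(1 / norm x) *\<^sub>R x \<in> sphere 0 1 \<inter> LTri"
      using that by (auto intro: subspace_scale[OF subspace_LTri])
    then show False using True by blast
  qed
  then have "\<forall>x\<in>LTri. 1 * (norm x)\<^sup>2 \<le> Q x x" using Q.zero_left by fastforce
  then show ?thesis using zero_less_one by blast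
next
  case False
  have "compact (sphere 0 1 \<inter> LTri :: 'n sqmat set)"
    by (intro compact_Int_closed closed_subspace subspace_LTri) simp
  moreover have "continuous_on (sphere 0 1 \<inter> LTri) (\<lambda>x. Q x x)"
    by (intro Q.continuous_on continuous_on_id)
  ultimately obtain x0 where x0: "x0 \<in> sphere 0 1 \<inter> LTri"
      and min: "\<And>y. y \<in> sphere 0 1 \<inter> LTri \<Longrightarrow> Q x0 x0 \<le> Q y y"
    using continuous_attains_inf[OF _ False] by blast
  have "0 < Q x0 x0" using x0 by (intro Q_pos) auto
  moreover have "Q x0 x0 * (norm x)\<^sup>2 \<le> Q x x" if "x \<in> LTri" for x
  proof (cases "x = 0")
    case False
    have "Q x0 x0 \<le> Q ((1 / norm x) *\<^sub>R x) ((1 / norm x) *\<^sub>R x)"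
      using False that by (intro min) (auto intro: subspace_scale[OF subspace_LTri])
    also have "\<dots> = Q x x / (norm x)\<^sup>2"
      by (simp add: Q.scaleR_left Q.scaleR_right power2_eq_square)
    finally show ?thesis using False by (simp add: pos_le_divide_eq)
  qed (simp add: Q.zero_left)
  ultimately show ?thesis by blast
qed

text \<open>This is the \<open>Q\<close>-transpose of the bracket with \<open>y\<close>, applied to
  \<open>x\<close>; the Euler-Arnold field is its diagonal. Keeping two arguments makes it bilinear,
  which yields the Lipschitz estimates.\<close>

definition euler_arnold :: "'n sqmat \<Rightarrow> 'n sqmat \<Rightarrow> 'n sqmat" where
  "euler_arnold x y = (THE w. w \<in> LTri \<and> (\<forall>z\<in>LTri. Q w z = Q x (y ** z - z ** y)))"

lemma euler_arnold_ex: "\<exists>w\<in>LTri. \<forall>z\<in>LTri. Q w z = Q x (y ** z - z ** y)"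
  by (rule riesz_subspace[OF subspace_LTri])
    (auto simp: Q.add_left Q.add_right Q.scaleR_left Q.scaleR_right Q_pos Q.diff_right
      mm.add_left mm.add_right mm.scaleR_left mm.scaleR_right algebra_simps)

lemma Q_determines:
  assumes "w \<in> LTri" "w' \<in> LTri" "\<And>z. z \<in> LTri \<Longrightarrow> Q w z = Q w' z"
  shows "w = w'"
proof (rule ccontr)
  assume "w \<noteq> w'"
  have "w - w' \<in> LTri" using assms subspace_diff[OF subspace_LTri] by blast
  then have "0 < Q (w - w') (w - w')" using \<open>w \<noteq> w'\<close> by (intro Q_pos) auto
  then show False using assms(3)[OF \<open>w - w' \<in> LTri\<close>] by (simp add: Q.diff_left)
qed

lemma euler_arnold_eqI:
  assumes "w \<in> LTri" "\<And>z. z \<in> LTri \<Longrightarrow> Q w z = Q x (y ** z - z ** y)"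
  shows "euler_arnold x y = w"
  unfolding euler_arnold_def using assms by (intro the_equality) (auto intro!: Q_determines)

lemma euler_arnold_LTri: "euler_arnold x y \<in> LTri"
  and Q_euler_arnold: "z \<in> LTri \<Longrightarrow> Q (euler_arnold x y) z = Q x (y ** z - z ** y)"
  using euler_arnold_ex[of x y] euler_arnold_eqI[of _ x y] by auto

lemma bounded_bilinear_euler_arnold: "bounded_bilinear euler_arnold"
proof -
  have "bilinear euler_arnold"
    unfolding bilinear_def linear_iff
    by (auto intro!: euler_arnold_eqI subspace_add[OF subspace_LTri] subspace_scale[OF subspace_LTri] euler_arnold_LTri
        simp: Q.add_left Q.add_right Q.scaleR_left Q.scaleR_right Q.diff_right Q_euler_arnold
        mm.add_left mm.add_right mm.scaleR_left mm.scaleR_right algebra_simps)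
  then show ?thesis by (simp add: bilinear_conv_bounded_bilinear)
qed

sublocale euler_arnold: bounded_bilinear euler_arnold
  by (rule bounded_bilinear_euler_arnold)

text \<open>The bracket of \<open>x\<close> with itself vanishes; this is the infinitesimal form of
  energy conservation.\<close>

lemma Q_euler_arnold_self: "x \<in> LTri \<Longrightarrow> Q (euler_arnold x x) x = 0"
  by (simp add: Q_euler_arnold Q.zero_right)

text \<open>The quadratic field is truncated radially, which keeps the energy \<open>Q w w\<close> constant; the energy bound
  then shows that the truncation is never active.\<close>

lemma euler_arnold_flow:
  assumes "w0 \<in> LTri"
  shows "\<exists>w R. w 0 = w0 \<and> (\<forall>t. w t \<in> LTri \<and> norm (w t) \<le> R
    \<and> (w has_vector_derivative euler_arnold (w t) (w t)) (at t))"
proof -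
  obtain c where "0 < c" and c: "\<And>x. x \<in> LTri \<Longrightarrow> c * (norm x)\<^sup>2 \<le> Q x x"
    using Q_coercive by blast
  \<comment> \<open>Constant energy and coercivity confine the solution to the radius
    \<open>sqrt (Q w0 w0 / c)\<close>; the added 1 keeps \<open>R\<close> positive when
    \<open>w0 = 0\<close>.\<close>
  define R where "R = sqrt (Q w0 w0 / c) + 1"
  have "0 \<le> Q w0 w0" using Q_pos[OF assms] Q.zero_left by (cases "w0 = 0") force+
  then have "0 < R" using \<open>0 < c\<close> by (simp add: R_def add_nonneg_pos)
  define P :: "'n sqmat \<Rightarrow> 'n sqmat" where "P = closest_point (cball 0 R)"
  have P_le: "norm (P x) \<le> R" for x
    using closest_point_in_set[of "cball 0 R" x] \<open>0 < R\<close> by (simp add: P_def)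
  have P_lip: "norm (P x - P y) \<le> norm (x - y)" for x y
    using closest_point_lipschitz[of "cball 0 R" x y] \<open>0 < R\<close> by (simp add: P_def dist_norm)
  have P_id: "P x = x" if "norm x \<le> R" for x
    using that by (simp add: P_def closest_point_self)
  define F where "F x = euler_arnold (P x) (P x)" for x
  obtain K where "0 < K" and K: "\<And>x y. norm (euler_arnold x y) \<le> norm x * norm y * K"
    using euler_arnold.pos_bounded by blast
  have lip: "norm (F x - F y) \<le> 2 * R * K * norm (x - y)" for x y
  proof -
    have "F x - F y = euler_arnold (P x - P y) (P x) + euler_arnold (P y) (P x - P y)"
      by (simp add: F_def euler_arnold.diff_left euler_arnold.diff_right)
    then have "norm (F x - F y) \<le> norm (euler_arnold (P x - P y) (P x)) + norm (euler_arnold (P y) (P x - P y))"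
      by (metis norm_triangle_ineq)
    also have "\<dots> \<le> norm (P x - P y) * norm (P x) * K + norm (P y) * norm (P x - P y) * K"
      by (intro add_mono K)
    also have "\<dots> \<le> norm (x - y) * R * K + R * norm (x - y) * K"
      using \<open>0 < K\<close> \<open>0 < R\<close> by (intro add_mono mult_right_mono mult_mono P_le P_lip) auto
    finally show ?thesis by (simp add: algebra_simps)
  qed
  have "(2 * R * K)-lipschitz_on UNIV F"
    using lip \<open>0 < K\<close> \<open>0 < R\<close> by (intro lipschitz_onI) (auto simp: dist_norm)
  then have contF: "continuous_on UNIV F" by (rule lipschitz_on_continuous_on)
  have "\<exists>w. w 0 = w0 \<and> (\<forall>t. (w has_vector_derivative F (w t)) (at t))"
  proof (rule ode_global_existence[where F = "\<lambda>t. F" and K = "2 * R * K" and M = "norm (F w0)"])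
    have "continuous_on UNIV (\<lambda>p :: real \<times> 'n sqmat. F (snd p))"
      by (rule continuous_on_compose2[OF contF continuous_on_snd[OF continuous_on_id]]) auto
    then show "continuous_on UNIV (\<lambda>(t :: real, x). F x)" by (simp add: case_prod_beta')
  qed (use lip \<open>0 < K\<close> \<open>0 < R\<close> in auto)
  then obtain w where w0: "w 0 = w0" and w: "\<And>t. (w has_vector_derivative F (w t)) (at t)"
    by blast
  have LT: "w t \<in> LTri" for t
    by (rule has_vector_derivative_stays_LTri[OF w]) (auto simp: F_def euler_arnold_LTri w0 assms)
  have "((\<lambda>t. Q (w t) (w t)) has_real_derivative 0) (at t)" for t
  proof -
    \<comment> \<open>Truncation only rescales the field: \<open>F (w t)\<close> is
      \<open>r * r\<close> times the Euler-Arnold field at \<open>w t\<close>, hence still preserves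
      the energy.\<close>
    obtain r where r: "P (w t) = r *\<^sub>R w t"
      using closest_point_cball_0[OF \<open>0 < R\<close>] unfolding P_def by blast
    have "Q (F (w t)) (w t) = 0"
      by (simp add: F_def r euler_arnold.scaleR_left euler_arnold.scaleR_right Q.scaleR_left Q_euler_arnold_self LT)
    then show ?thesis
      unfolding has_real_derivative_iff_has_vector_derivative
      using Q.has_vector_derivative[OF w w, of t] Q_sym[of "w t"] by simp
  qed
  then have Q_const: "Q (w t) (w t) = Q w0 w0" for t
    using DERIV_isconst_all[of "\<lambda>t. Q (w t) (w t)" t 0] w0 by simp
  have bd: "norm (w t) \<le> R" for t
  proof -
    have "(norm (w t))\<^sup>2 \<le> Q w0 w0 / c"
      using c[OF LT[of t]] \<open>0 < c\<close> by (simp add: Q_const pos_le_divide_eq mult.commute)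
    then have "norm (w t) \<le> sqrt (Q w0 w0 / c)" by (rule real_le_rsqrt)
    then show ?thesis by (simp add: R_def)
  qed
  show ?thesis
    using w0 w LT bd P_id by (intro exI[of _ w] exI[of _ R]) (simp add: F_def)
qed

text \<open>A quadratic field is only locally Lipschitz, but both curves are bounded on the compact
  interval, and bilinearity gives a Lipschitz constant along them.\<close>

lemma euler_arnold_unique:
  assumes w1: "\<And>t. t \<in> {0..1} \<Longrightarrow> (w1 has_vector_derivative euler_arnold (w1 t) (w1 t)) (at t within {0..1})"
    and w2: "\<And>t. t \<in> {0..1} \<Longrightarrow> (w2 has_vector_derivative euler_arnold (w2 t) (w2 t)) (at t within {0..1})"
    and "w1 0 = w2 0" and t: "t \<in> {0..1}"
  shows "w1 t = w2 t"
proof -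
  have "continuous_on {0..1} w1" "continuous_on {0..1} w2"
    unfolding continuous_on_eq_continuous_within
    using w1 w2 has_vector_derivative_continuous by blast+
  then have "bounded (w1 ` {0..1})" "bounded (w2 ` {0..1})"
    by (auto intro: compact_imp_bounded compact_continuous_image)
  then obtain R1 R2 where R1: "\<And>t. t \<in> {0..1} \<Longrightarrow> norm (w1 t) \<le> R1"
      and R2: "\<And>t. t \<in> {0..1} \<Longrightarrow> norm (w2 t) \<le> R2"
    unfolding bounded_iff by (metis imageI)
  obtain K where "0 < K" and K: "\<And>x y. norm (euler_arnold x y) \<le> norm x * norm y * K"
    using euler_arnold.pos_bounded by blast
  have "w1 t - w2 t = 0"
  proof (rule gronwall_vec[where K = "(R1 + R2) * K"])
    show "w1 0 - w2 0 = 0" using assms by simp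
    show "((\<lambda>t. w1 t - w2 t) has_vector_derivative euler_arnold (w1 s) (w1 s) - euler_arnold (w2 s) (w2 s))
      (at s within {0..1})" if "s \<in> {0..1}" for s
      by (intro has_vector_derivative_diff w1 w2 that)
    show "norm (euler_arnold (w1 s) (w1 s) - euler_arnold (w2 s) (w2 s)) \<le> (R1 + R2) * K * norm (w1 s - w2 s)"
      if "s \<in> {0..1}" for s
    proof -
      have "euler_arnold (w1 s) (w1 s) - euler_arnold (w2 s) (w2 s) = euler_arnold (w1 s - w2 s) (w1 s) + euler_arnold (w2 s) (w1 s - w2 s)"
        by (simp add: euler_arnold.diff_left euler_arnold.diff_right)
      then have "norm (euler_arnold (w1 s) (w1 s) - euler_arnold (w2 s) (w2 s))
          \<le> norm (euler_arnold (w1 s - w2 s) (w1 s)) + norm (euler_arnold (w2 s) (w1 s - w2 s))"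
        by (metis norm_triangle_ineq)
      also have "\<dots> \<le> norm (w1 s - w2 s) * norm (w1 s) * K + norm (w2 s) * norm (w1 s - w2 s) * K"
        by (intro add_mono K)
      also have "\<dots> \<le> norm (w1 s - w2 s) * R1 * K + R2 * norm (w1 s - w2 s) * K"
        using \<open>0 < K\<close> R1[OF that] R2[OF that]
        by (intro add_mono mult_right_mono mult_mono) auto
      finally show ?thesis by (simp add: algebra_simps)
    qed
  qed (rule t)
  then show ?thesis by simp
qed

end

text \<open>Boundedness of \<open>w\<close> makes the linear equation globally Lipschitz, so the
  solution exists for all times; what remains is that it does not leave
  \<open>LTpos\<close>.\<close>

lemma reconstruction_exists:
  fixes w :: "real \<Rightarrow> 'n::{finite,linorder} sqmat"
  assumes w: "continuous_on UNIV w" "\<And>t. w t \<in> LTri" "\<And>t. norm (w t) \<le> R" and p: "p \<in> LTpos"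
  shows "\<exists>L. L 0 = p \<and> (\<forall>t. L t \<in> LTpos \<and> (L has_vector_derivative L t ** w t) (at t))"
proof -
  have bl_low: "bounded_linear (low :: 'n sqmat \<Rightarrow> 'n sqmat)"
    using linear_low linear_conv_bounded_linear by blast
  obtain K1 where "0 < K1" and K1: "\<And>x :: 'n sqmat. norm (low x) \<le> norm x * K1"
    using bounded_linear.pos_bounded[OF bl_low] by blast
  obtain K2 where "0 < K2"
    and K2: "\<And>(x :: 'n sqmat) (y :: 'n sqmat). norm (x ** y) \<le> norm x * norm y * K2"
    using mm.pos_bounded by blast
  have "0 \<le> R" using w(3)[of 0] norm_ge_zero order_trans by blast
  have F_bd: "norm (low x ** w t) \<le> (K1 * (R + 1) * K2) * norm x" for x t
  proof -
    have "norm (low x ** w t) \<le> norm (low x) * norm (w t) * K2" by (rule K2)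
    also have "\<dots> \<le> (norm x * K1) * (R + 1) * K2"
      using \<open>0 < K2\<close> \<open>0 < K1\<close> \<open>0 \<le> R\<close> w(3)[of t]
      by (intro mult_right_mono mult_mono K1) auto
    finally show ?thesis by (simp add: algebra_simps)
  qed
  \<comment> \<open>With \<open>low\<close> the right-hand side lies in \<open>LTri\<close> for
    every argument, so the solution stays in \<open>LTri\<close>, and \<open>low\<close> can then be
    dropped.\<close>
  have "\<exists>L. L 0 = p \<and> (\<forall>t. (L has_vector_derivative low (L t) ** w t) (at t))"
  proof (rule ode_global_existence[where F = "\<lambda>t x. low x ** w t"])
    have "continuous_on UNIV (\<lambda>p. low (snd p) ** w (fst p))"
      by (intro mm.continuous_on bounded_linear.continuous_on[OF bl_low]
          continuous_on_compose2[OF w(1)] continuous_intros) auto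
    then show "continuous_on UNIV (\<lambda>(t, x). low x ** w t)" by (simp add: case_prod_beta')
    show "norm (low x ** w t - low y ** w t) \<le> (K1 * (R + 1) * K2) * norm (x - y)" for t x y
      using F_bd[of "x - y" t] by (simp add: linear_diff[OF linear_low] mm.diff_left)
    show "norm (low p ** w t) \<le> (K1 * (R + 1) * K2) * norm p" for t by (rule F_bd)
    show "0 < K1 * (R + 1) * K2" using \<open>0 < K1\<close> \<open>0 < K2\<close> \<open>0 \<le> R\<close> by simp
  qed
  then obtain L where L0: "L 0 = p" and L: "\<And>t. (L has_vector_derivative low (L t) ** w t) (at t)"
    by blast
  have LT: "L t \<in> LTri" for t
    by (rule has_vector_derivative_stays_LTri[OF L])
      (auto simp: L0 p LTpos_LTri intro!: LTri_mult low_LTri w)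
  have L': "(L has_vector_derivative L t ** w t) (at t)" for t
    using L[of t] low_id[OF LT[of t]] by simp
  have "L t $ i $ i > 0" for t i
  proof -
    have bl: "bounded_linear (\<lambda>M :: 'n sqmat. M $ i $ i)"
      unfolding linear_conv_bounded_linear[symmetric] by (rule linearI) auto
    have "continuous_on UNIV (\<lambda>t. w t $ i $ i)"
      by (rule bounded_linear.continuous_on[OF bl w(1)])
    then obtain W where W: "W 0 = 0" "\<And>t. (W has_vector_derivative w t $ i $ i) (at t)"
      using antiderivative_real by metis
    have L_ii: "((\<lambda>t. L t $ i $ i) has_real_derivative L s $ i $ i * w s $ i $ i) (at s)" for s
      using bounded_linear.has_vector_derivative[OF bl L'[of s]]
      by (simp add: LTri_mult_diag LT w has_real_derivative_iff_has_vector_derivative)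
    have W': "(W has_real_derivative w s $ i $ i) (at s)" for s
      using W(2) by (simp add: has_real_derivative_iff_has_vector_derivative)
    \<comment> \<open>A diagonal entry of a triangular product is the product of the diagonal
      entries, so each diagonal entry of \<open>L\<close> solves a scalar linear equation and keeps
      its sign.\<close>
    have "((\<lambda>t. L t $ i $ i * exp (- W t)) has_real_derivative 0) (at s)" for s
      by (rule derivative_eq_intros L_ii W' refl)+ simp
    then have "L t $ i $ i * exp (- W t) = L 0 $ i $ i * exp (- W 0)"
      using DERIV_isconst_all by blast
    moreover have "0 < p $ i $ i" using p by (simp add: LTpos_def)
    ultimately have "0 < L t $ i $ i * exp (- W t)" by (simp add: L0 W(1))
    then show ?thesis by (simp add: zero_less_mult_iff)
  qed
  then have "L t \<in> LTpos" for t using LT by (simp add: LTpos_def)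
  with L0 L' show ?thesis by blast
qed

text \<open>Relative openness of \<open>LTpos\<close> in \<open>LTri\<close>, in the form in which
  \<open>christoffel_iff\<close> compares a metric with its extension near \<open>p\<close>.\<close>

lemma eventually_LTpos_line:
  assumes "p \<in> LTpos" "z \<in> LTri"
  shows "\<forall>\<^sub>F s in nhds 0. p + s *\<^sub>R z \<in> LTpos"
proof -
  have "\<forall>\<^sub>F s in nhds 0. 0 < p $ i $ i + s * z $ i $ i" for i
  proof -
    have "continuous_on UNIV (\<lambda>s. p $ i $ i + s * z $ i $ i)" by (intro continuous_intros)
    then have "open ((\<lambda>s. p $ i $ i + s * z $ i $ i) -` {0<..})"
      by (rule open_vimage[rotated]) simp
    then show ?thesis
      by (rule eventually_nhds_in_open[THEN eventually_mono]) (use assms in \<open>auto simp: LTpos_def\<close>)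
  qed
  then have "\<forall>\<^sub>F s in nhds 0. \<forall>i. 0 < p $ i $ i + s * z $ i $ i"
    by (simp add: eventually_all_finite)
  then show ?thesis
    by eventually_elim (use assms in \<open>auto simp: LTpos_def LTri_def\<close>)
qed

lemma LT1_line: "p \<in> LT1 \<Longrightarrow> z \<in> LT0 \<Longrightarrow> p + s *\<^sub>R z \<in> LT1"
  by (auto simp: LT1_def LT0_def LTri_def)

text \<open>The left trivialization of the vertical vector \<open>dg d ** q\<close>; in group terms,
  the adjoint action of the inverse of \<open>q\<close> on the Lie algebra of the diagonal
  group.\<close>

definition Ad :: "'n sqmat \<Rightarrow> real^'n \<Rightarrow> 'n::finite sqmat" where
  "Ad q d = matrix_inv q ** dg d ** q"

lemma linear_Ad: "linear (Ad q)"
  by (rule linearI)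
    (simp_all add: Ad_def linear_add[OF linear_dg] linear_scale[OF linear_dg]
      mm.add_left mm.add_right mm.scaleR_left mm.scaleR_right)

text \<open>Conjugates of diagonal matrices by the same \<open>q\<close> commute. Hence vertical
  parts drop out of brackets with \<open>Ad q e\<close>, which is why momentum is conserved.\<close>

lemma Ad_commute:
  assumes "invertible q"
  shows "Ad q d ** Ad q e = Ad q e ** Ad q d"
proof -
  have "Ad q d ** Ad q e = matrix_inv q ** (dg d ** dg e) ** q" for d e
    by (simp add: Ad_def matrix_mul_assoc[symmetric] matrix_inv_right_mult[OF assms])
  then show ?thesis using dg_commute[of d e] by simp
qed

lemma Ad_LTri: "q \<in> LTpos \<Longrightarrow> Ad q d \<in> LTri"
  unfolding Ad_def by (intro LTri_mult LTpos_inv_LTri dg_LTri LTpos_LTri)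

lemma Ad_eq_0: "invertible q \<Longrightarrow> Ad q d = 0 \<Longrightarrow> d = 0"
proof -
  assume q: "invertible q" and "Ad q d = 0"
  then have "q ** Ad q d ** matrix_inv q = 0" by (simp add: mm.zero_left mm.zero_right)
  then have "dg d = 0"
    by (simp add: Ad_def matrix_mul_assoc[symmetric] matrix_inv_right_mult[OF q] matrix_inv_right[OF q])
  then show "d = 0" by (auto simp: dg_def vec_eq_iff split: if_splits)
qed

text \<open>Commutativity of diagonal matrices makes the trivialized vertical space constant along
  each fiber.\<close>

lemma Ad_dg_mult:
  assumes "\<And>i. d $ i \<noteq> 0" "invertible q"
  shows "Ad (dg d ** q) e = Ad q e"
  using dg_inv[OF assms(1)] assms
  by (simp add: Ad_def matrix_inv_mult matrix_mul_assoc[symmetric])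
    (metis dg_commute matrix_inv_left_mult matrix_mul_assoc)

section \<open>Geodesics of the Lie-Cholesky metric\<close>

context lie_cholesky
begin

lemma LC_eq:
  assumes "L \<in> LTpos" "x \<in> LTri" "y \<in> LTri"
  shows "LC f L x y = Q (matrix_inv L ** x) (matrix_inv L ** y)"
  unfolding LC_def using assms by (simp add: Q_eq LTri_mult LTpos_inv_LTri)

text \<open>The left-hand vector is the acceleration of a curve with \<open>L' = L w\<close>, by the
  product rule. Rewritten with test vectors \<open>matrix_inv p ** z\<close>, the weak geodesic
  equation loses its dependence on \<open>p\<close>, by left invariance.\<close>

lemma LC_christoffel_iff:
  assumes p: "p \<in> LTpos" and w: "w \<in> LTri" and w': "w' \<in> LTri"
  shows "p ** w' + p ** w ** w = - christoffel LTri (LC f) p (p ** w) (p ** w) \<longleftrightarrow> w' = euler_arnold w w"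
proof -
  note inv = LTpos_invertible[OF p]
  define u where "u = p ** w"
  define a where "a = p ** w' + p ** w ** w"
  have iu: "matrix_inv p ** u = w" by (simp add: u_def matrix_inv_left_mult inv)
  have ia: "matrix_inv p ** a = w' + w ** w"
    by (simp add: a_def mm.add_right matrix_inv_left_mult inv matrix_mul_assoc[symmetric])
  have uV: "u \<in> LTri" and aV: "a \<in> LTri"
    using p w w' by (auto simp: u_def a_def LTpos_LTri intro!: LTri_mult subspace_add[OF subspace_LTri])
  define D where "D z xa = Q (matrix_inv p ** u) (- (matrix_inv p ** fst xa ** matrix_inv p) ** z)
      + Q (matrix_inv p ** snd xa + - (matrix_inv p ** fst xa ** matrix_inv p) ** u) (matrix_inv p ** z)"
    for z :: "'n sqmat" and xa :: "'n sqmat \<times> 'n sqmat"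
  have D: "((\<lambda>(q, v). Q (matrix_inv q ** v) (matrix_inv q ** z)) has_derivative D z) (at (p, u))" for z
  proof -
    have dinv: "((\<lambda>x :: 'n sqmat \<times> 'n sqmat. matrix_inv (fst x)) has_derivative
        (\<lambda>h. - (matrix_inv p ** fst h ** matrix_inv p))) (at (p, u))"
      using has_derivative_matrix_inv[OF has_derivative_fst[OF has_derivative_ident], of "(p, u)"] inv
      by simp
    have "((\<lambda>x. Q (matrix_inv (fst x) ** snd x) (matrix_inv (fst x) ** z)) has_derivative D z) (at (p, u))"
      by (rule has_derivative_eq_rhs[OF Q.FDERIV[OF mm.FDERIV[OF dinv has_derivative_snd[OF has_derivative_ident]]
              mm.FDERIV[OF dinv has_derivative_const]]])
        (simp add: D_def fun_eq_iff mm.zero_right)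
    then show ?thesis by (simp add: case_prod_beta')
  qed
  have "a = - christoffel LTri (LC f) p u u \<longleftrightarrow> (\<forall>z\<in>LTri. 2 * D z (u, a) = D u (z, 0))"
  proof (rule christoffel_iff[OF subspace_LTri uV aV, where h = "\<lambda>q v z. Q (matrix_inv q ** v) (matrix_inv q ** z)"
        and b = "\<lambda>x y. Q (matrix_inv p ** x) (matrix_inv p ** y)"])
    show "bilinear (\<lambda>x y. Q (matrix_inv p ** x) (matrix_inv p ** y))"
      by (auto simp: bilinear_def linear_iff Q.add_left Q.add_right Q.scaleR_left Q.scaleR_right
          mm.add_right mm.scaleR_right)
    show "0 < Q (matrix_inv p ** x) (matrix_inv p ** x)" if "x \<in> LTri" "x \<noteq> 0" for x
    proof (rule Q_pos)
      show "matrix_inv p ** x \<in> LTri" using p that by (intro LTri_mult LTpos_inv_LTri)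
      show "matrix_inv p ** x \<noteq> 0"
        using matrix_inv_right_mult[OF inv, of x] that(2) by (auto simp: mm.zero_right)
    qed
    show "LC f p x y = Q (matrix_inv p ** x) (matrix_inv p ** y)" if "x \<in> LTri" "y \<in> LTri" for x y
      by (rule LC_eq[OF p that])
    show "\<forall>\<^sub>F s in nhds 0. LC f (p + s *\<^sub>R z) x y
        = Q (matrix_inv (p + s *\<^sub>R z) ** x) (matrix_inv (p + s *\<^sub>R z) ** y)"
      if "x \<in> LTri" "y \<in> LTri" "z \<in> LTri" for x y z
      using eventually_LTpos_line[OF p that(3)] by eventually_elim (rule LC_eq[OF _ that(1,2)])
    show "linear (\<lambda>z. Q (matrix_inv q ** v) (matrix_inv q ** z))" for q v
      by (rule linearI) (simp_all add: Q.add_right Q.scaleR_right mm.add_right mm.scaleR_right)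
  qed (rule D)
  also have "\<dots> \<longleftrightarrow> (\<forall>z\<in>LTri. Q w' (matrix_inv p ** z)
      = Q w (w ** (matrix_inv p ** z) - (matrix_inv p ** z) ** w))"
  proof (rule ball_cong[OF refl])
    fix z :: "'n sqmat"
    define \<zeta> where "\<zeta> = matrix_inv p ** z"
    \<comment> \<open>The term \<open>w ** w\<close> of the trivialized acceleration cancels against
      the derivative of the inverse in the first slot.\<close>
    have "D z (u, a) = - Q w (w ** \<zeta>) + Q w' \<zeta>"
      by (simp add: D_def iu ia \<zeta>_def mm.minus_left matrix_mul_assoc[symmetric] Q.minus_right)
    moreover have "D u (z, 0) = - 2 * Q w (\<zeta> ** w)"
      using Q_sym[of "\<zeta> ** w" w]
      by (simp add: D_def iu mm.zero_right mm.minus_left matrix_mul_assoc[symmetric] Q.minus_right Q.minus_left)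
        (simp add: \<zeta>_def matrix_mul_assoc[symmetric])
    ultimately show "2 * D z (u, a) = D u (z, 0) \<longleftrightarrow>
        Q w' (matrix_inv p ** z) = Q w (w ** (matrix_inv p ** z) - (matrix_inv p ** z) ** w)"
      unfolding \<zeta>_def[symmetric] by (auto simp: Q.diff_right)
  qed
  \<comment> \<open>Multiplication by \<open>p\<close> permutes \<open>LTri\<close>, so the vectors
    \<open>matrix_inv p ** z\<close> exhaust all test vectors.\<close>
  also have "\<dots> \<longleftrightarrow> w' = euler_arnold w w"
  proof
    assume *: "\<forall>z\<in>LTri. Q w' (matrix_inv p ** z)
      = Q w (w ** (matrix_inv p ** z) - (matrix_inv p ** z) ** w)"
    have "Q w' z = Q w (w ** z - z ** w)" if "z \<in> LTri" for z
      using bspec[OF *, of "p ** z"] that p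
      by (simp add: matrix_inv_left_mult inv LTri_mult LTpos_LTri)
    then show "w' = euler_arnold w w" using euler_arnold_eqI[OF w'] by metis
  qed (use p in \<open>auto simp: Q_euler_arnold LTri_mult LTpos_inv_LTri\<close>)
  finally show ?thesis by (simp add: u_def a_def)
qed

lemma LC_geodesicI:
  assumes L: "\<And>t. t \<in> I \<Longrightarrow> L t \<in> LTpos"
    and w_LT: "\<And>t. t \<in> I \<Longrightarrow> w t \<in> LTri"
    and L': "\<And>t. t \<in> I \<Longrightarrow> (L has_vector_derivative L t ** w t) (at t within I)"
    and w': "\<And>t. t \<in> I \<Longrightarrow> (w has_vector_derivative euler_arnold (w t) (w t)) (at t within I)"
  shows "is_geodesic LTri LTpos (LC f) I L"
  unfolding is_geodesic_def
proof (intro conjI ballI exI[of _ "\<lambda>t. L t ** w t"])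
  fix t assume t: "t \<in> I"
  show "L t \<in> LTpos" and "(L has_vector_derivative L t ** w t) (at t within I)"
    using L L' t by blast+
  have "((\<lambda>t. L t ** w t) has_vector_derivative L t ** euler_arnold (w t) (w t) + L t ** w t ** w t) (at t within I)"
    by (rule has_vector_derivative_matmul[OF L'[OF t] w'[OF t]])
  then show "((\<lambda>t. L t ** w t) has_vector_derivative
      - christoffel LTri (LC f) (L t) (L t ** w t) (L t ** w t)) (at t within I)"
    using LC_christoffel_iff[OF L w_LT euler_arnold_LTri, OF t t, of "w t" "w t"] by simp
qed

lemma LC_geodesicD:
  assumes "is_geodesic LTri LTpos (LC f) I L" and nt: "\<And>t. t \<in> I \<Longrightarrow> at t within I \<noteq> bot"
  shows "\<exists>w. \<forall>t\<in>I. L t \<in> LTpos \<and> (L has_vector_derivative L t ** w t) (at t within I)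
    \<and> (w has_vector_derivative euler_arnold (w t) (w t)) (at t within I)"
proof -
  from assms(1) obtain u where L: "\<And>t. t \<in> I \<Longrightarrow> L t \<in> LTpos"
    and L': "\<And>t. t \<in> I \<Longrightarrow> (L has_vector_derivative u t) (at t within I)"
    and u': "\<And>t. t \<in> I \<Longrightarrow> (u has_vector_derivative - christoffel LTri (LC f) (L t) (u t) (u t)) (at t within I)"
    unfolding is_geodesic_def by blast
  define a where "a t = - christoffel LTri (LC f) (L t) (u t) (u t)" for t
  define w where "w t = matrix_inv (L t) ** u t" for t
  \<comment> \<open>The product rule for \<open>matrix_inv (L t) ** u t\<close>: differentiating the
    inverse contributes \<open>- w t ** w t\<close>.\<close>
  define w' where "w' t = matrix_inv (L t) ** a t - w t ** w t" for t
  have inv: "invertible (L t)" if "t \<in> I" for t using L[OF that] by (rule LTpos_invertible)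
  have u_eq: "u t = L t ** w t" if "t \<in> I" for t
    by (simp add: w_def matrix_inv_right_mult inv that)
  have u_LT: "u t \<in> LTri" if t: "t \<in> I" for t
  proof -
    have "u t $ i $ j = 0" if "i < j" for i j
      by (rule has_vector_derivative_const_entry[OF _ t L'[OF t] nt[OF t], where c = 0])
        (use L that in \<open>auto simp: LTpos_def LTri_def\<close>)
    then show ?thesis by (simp add: LTri_def)
  qed
  have a_LT: "a t \<in> LTri" if t: "t \<in> I" for t
  proof -
    have "a t $ i $ j = 0" if "i < j" for i j
      unfolding a_def
      by (rule has_vector_derivative_const_entry[OF _ t u'[OF t] nt[OF t], where c = 0])
        (use u_LT that in \<open>auto simp: LTri_def\<close>)
    then show ?thesis by (simp add: LTri_def)
  qed
  have w_deriv: "(w has_vector_derivative w' t) (at t within I)" if t: "t \<in> I" for t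
    using has_vector_derivative_matmul[OF has_vector_derivative_matrix_inv[OF L'[OF t] inv[OF t]] u'[OF t]]
    unfolding w_def[abs_def] w'_def a_def
    by (simp add: mm.minus_left mm.minus_right matrix_mul_assoc)
  have w_LT: "w t \<in> LTri" if "t \<in> I" for t
    unfolding w_def by (intro LTri_mult LTpos_inv_LTri L u_LT that)
  have w'_LT: "w' t \<in> LTri" if "t \<in> I" for t
    unfolding w'_def by (intro subspace_diff[OF subspace_LTri] LTri_mult LTpos_inv_LTri L a_LT w_LT that)
  have "w' t = euler_arnold (w t) (w t)" if "t \<in> I" for t
  proof -
    have "a t = L t ** w' t + L t ** w t ** w t"
      by (simp add: w'_def mm.diff_right matrix_inv_right_mult inv that matrix_mul_assoc[symmetric])
    then show ?thesis
      using LC_christoffel_iff[OF L w_LT w'_LT, OF that that that] u_eq[OF that] by (simp add: a_def)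
  qed
  then show ?thesis using L L' w_deriv u_eq by (intro exI[of _ w]) auto
qed

end

text \<open>The map \<open>B\<close> covers both reconstruction equations: \<open>B = 0\<close> for
  curves in \<open>LTpos\<close> and \<open>B = Diag\<close> for their projections to
  \<open>LT1\<close>.\<close>

lemma linear_ode_unique:
  fixes L1 L2 w :: "real \<Rightarrow> 'n::finite sqmat"
  assumes h: "\<And>x y. h x y = x ** y - B y ** x" and B: "bounded_linear B"
    and L1: "\<And>t. t \<in> {0..1} \<Longrightarrow> (L1 has_vector_derivative h (L1 t) (w t)) (at t within {0..1})"
    and L2: "\<And>t. t \<in> {0..1} \<Longrightarrow> (L2 has_vector_derivative h (L2 t) (w t)) (at t within {0..1})"
    and w: "continuous_on {0..1} w" and "L1 0 = L2 0" and t: "t \<in> {0..1}"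
  shows "L1 t = L2 t"
proof -
  have "bounded (w ` {0..1})"
    using w by (auto intro: compact_imp_bounded compact_continuous_image)
  then obtain R where R: "\<And>t. t \<in> {0..1} \<Longrightarrow> norm (w t) \<le> R"
    unfolding bounded_iff by (metis imageI)
  obtain K where "0 < K" and K: "\<And>(x :: 'n sqmat) (y :: 'n sqmat). norm (x ** y) \<le> norm x * norm y * K"
    using mm.pos_bounded by blast
  obtain C where "0 < C" and C: "\<And>x. norm (B x) \<le> norm x * C"
    using bounded_linear.pos_bounded[OF B] by blast
  have "L1 t - L2 t = 0"
  proof (rule gronwall_vec[where K = "R * K + R * C * K"])
    show "((\<lambda>t. L1 t - L2 t) has_vector_derivative h (L1 s) (w s) - h (L2 s) (w s)) (at s within {0..1})"
      if "s \<in> {0..1}" for s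
      by (intro has_vector_derivative_diff L1 L2 that)
    show "norm (h (L1 s) (w s) - h (L2 s) (w s)) \<le> (R * K + R * C * K) * norm (L1 s - L2 s)"
      if "s \<in> {0..1}" for s
    proof -
      define e where "e = L1 s - L2 s"
      have "h (L1 s) (w s) - h (L2 s) (w s) = e ** w s - B (w s) ** e"
        by (simp add: h e_def mm.diff_left mm.diff_right)
      also have "norm \<dots> \<le> norm (e ** w s) + norm (B (w s) ** e)"
        by (rule norm_triangle_ineq4)
      also have "\<dots> \<le> norm e * norm (w s) * K + norm (B (w s)) * norm e * K"
        by (intro add_mono K)
      also have "\<dots> \<le> norm e * R * K + (R * C) * norm e * K"
      proof (intro add_mono mult_right_mono mult_left_mono R that)
        show "norm (B (w s)) \<le> R * C"
          using C[of "w s"] R[OF that] \<open>0 < C\<close> by (meson less_imp_le mult_right_mono order_trans)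
      qed (use \<open>0 < K\<close> in auto)
      finally show ?thesis by (simp add: e_def algebra_simps)
    qed
  qed (use assms in auto)
  then show ?thesis by simp
qed

context lie_cholesky
begin

subsection \<open>Quotient metric\<close>

definition gram :: "'n sqmat \<Rightarrow> 'n sqmat" where
  "gram q = (\<chi> i j. Q (Ad q (axis i 1)) (Ad q (axis j 1)))"

text \<open>\<open>dg (vcoord q v) ** q\<close> is the vertical correction making \<open>v\<close> horizontal: its coordinates solve a
  linear system with the Gram matrix of the vertical space, hence depend smoothly on \<open>q\<close>. Then
  \<open>omega q v = q\<^sup>-\<^sup>1 hor\<^sub>q(v)\<close>.\<close>

definition vcoord :: "'n sqmat \<Rightarrow> 'n sqmat \<Rightarrow> (real, 'n) vec" where
  "vcoord q v = - (matrix_inv (gram q) *v (\<chi> i. Q (matrix_inv q ** v) (Ad q (axis i 1))))"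

definition omega :: "'n sqmat \<Rightarrow> 'n sqmat \<Rightarrow> 'n sqmat" where
  "omega q v = matrix_inv q ** v + Ad q (vcoord q v)"

lemma Q_Ad_right: "Q x (Ad q e) = (\<chi> i. Q x (Ad q (axis i 1))) \<bullet> e"
proof -
  have "(\<lambda>e. Q x (Ad q e)) = (\<lambda>e. (\<chi> i. Q x (Ad q (axis i 1))) \<bullet> e)"
    by (rule linear_eq_stdbasis)
      (auto intro!: linearI simp: linear_add[OF linear_Ad] linear_scale[OF linear_Ad]
        Q.add_right Q.scaleR_right inner_right_distrib Basis_vec_def inner_axis)
  then show ?thesis by metis
qed

lemma gram_mult: "(gram q *v d) $ i = Q (Ad q d) (Ad q (axis i 1))"
proof -
  have "(\<lambda>d. Q (Ad q d) (Ad q (axis i 1))) = (\<lambda>d. (gram q *v d) $ i)"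
  proof (rule linear_eq_stdbasis)
    show "linear (\<lambda>d. Q (Ad q d) (Ad q (axis i 1)))"
      by (rule linearI) (simp_all add: linear_add[OF linear_Ad] linear_scale[OF linear_Ad]
          Q.add_left Q.scaleR_left)
    show "linear (\<lambda>d. (gram q *v d) $ i)"
      by (rule linearI) (simp_all add: mv.add_right mv.scaleR_right)
    show "Q (Ad q b) (Ad q (axis i 1)) = (gram q *v b) $ i" if "b \<in> Basis" for b
      using that by (auto simp: Basis_vec_def matrix_vector_mult_basis column_def gram_def Q_sym)
  qed
  then show ?thesis by metis
qed

lemma gram_invertible:
  assumes q: "q \<in> LTpos"
  shows "invertible (gram q)"
proof -
  have "d = 0" if "gram q *v d = 0" for d
  proof -
    have "Q (Ad q d) (Ad q d) = 0"
      using that unfolding Q_Ad_right[of "Ad q d" q d] gram_mult[symmetric] by (simp add: inner_vec_def)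
    then have "Ad q d = 0" using Q_pos[OF Ad_LTri[OF q]] by fastforce
    then show ?thesis using Ad_eq_0 LTpos_invertible[OF q] by blast
  qed
  then have "\<exists>B. B ** gram q = mat 1" using matrix_left_invertible_ker by blast
  then show ?thesis using matrix_left_right_inverse unfolding invertible_def by blast
qed

lemma omega_horizontal:
  assumes q: "q \<in> LTpos"
  shows "Q (omega q v) (Ad q e) = 0"
proof -
  have "Q (Ad q (vcoord q v)) (Ad q (axis i 1)) = - Q (matrix_inv q ** v) (Ad q (axis i 1))" for i
    unfolding gram_mult[symmetric] vcoord_def mv.minus_right
    by (simp add: matrix_vector_mul_assoc matrix_inv_right gram_invertible q)
  then have "Q (omega q v) (Ad q (axis i 1)) = 0" for i
    by (simp add: omega_def Q.add_left)
  then show ?thesis by (subst Q_Ad_right) (simp add: inner_vec_def)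
qed

lemma omega_LTri: "q \<in> LTpos \<Longrightarrow> v \<in> LTri \<Longrightarrow> omega q v \<in> LTri"
  unfolding omega_def by (intro subspace_add[OF subspace_LTri] LTri_mult LTpos_inv_LTri Ad_LTri)

lemma mult_omega: "q \<in> LTpos \<Longrightarrow> q ** omega q v = v + dg (vcoord q v) ** q"
  by (simp add: omega_def mm.add_right Ad_def matrix_mul_assoc[symmetric] matrix_inv_right_mult
      LTpos_invertible)

text \<open>Two horizontal vectors with the same class modulo vertical vectors differ by a vertical
  vector orthogonal to all vertical ones, hence to itself.\<close>

lemma omega_eqI:
  assumes q: "q \<in> LTpos" and w: "w = matrix_inv q ** v + Ad q d" and h: "\<And>e. Q w (Ad q e) = 0"
  shows "omega q v = w"
proof -
  have diff: "omega q v - w = Ad q (vcoord q v - d)"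
    by (simp add: omega_def w linear_diff[OF linear_Ad])
  have "Q (omega q v - w) (omega q v - w) = 0"
    by (subst (2) diff) (simp add: Q.diff_left omega_horizontal[OF q] h)
  moreover have "omega q v - w \<in> LTri" unfolding diff by (rule Ad_LTri[OF q])
  ultimately have "omega q v - w = 0" using Q_pos by fastforce
  then show ?thesis by simp
qed

lemma linear_omega: "linear (omega q)"
proof (rule linearI)
  have d: "vcoord q (x + y) = vcoord q x + vcoord q y" "vcoord q (c *\<^sub>R x) = c *\<^sub>R vcoord q x" for x y c
  proof -
    have "(\<chi> i. Q (matrix_inv q ** (x + y)) (Ad q (axis i 1)))
      = (\<chi> i. Q (matrix_inv q ** x) (Ad q (axis i 1))) + (\<chi> i. Q (matrix_inv q ** y) (Ad q (axis i 1)))"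
      by (simp add: vec_eq_iff mm.add_right Q.add_left)
    then show "vcoord q (x + y) = vcoord q x + vcoord q y"
      unfolding vcoord_def by (simp add: mv.add_right)
    have "(\<chi> i. Q (matrix_inv q ** (c *\<^sub>R x)) (Ad q (axis i 1)))
      = c *\<^sub>R (\<chi> i. Q (matrix_inv q ** x) (Ad q (axis i 1)))"
      by (simp add: vec_eq_iff mm.scaleR_right Q.scaleR_left)
    then show "vcoord q (c *\<^sub>R x) = c *\<^sub>R vcoord q x"
      unfolding vcoord_def by (simp add: mv.scaleR_right)
  qed
  show "omega q (x + y) = omega q x + omega q y" "omega q (c *\<^sub>R x) = c *\<^sub>R omega q x" for x y c
    by (simp_all add: omega_def d mm.add_right mm.scaleR_right linear_add[OF linear_Ad]
        linear_scale[OF linear_Ad] algebra_simps)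
qed

lemma horizontal_iff:
  assumes L: "L \<in> LTpos" and H: "H \<in> LTri"
  shows "H \<in> horizontal f L \<longleftrightarrow> (\<forall>e. Q (matrix_inv L ** H) (Ad L e) = 0)"
proof -
  have "dg e ** L \<in> LTri" for e using L by (intro LTri_mult dg_LTri LTpos_LTri)
  then have "LC f L H (dg e ** L) = Q (matrix_inv L ** H) (Ad L e)" for e
    by (simp add: LC_eq[OF L H] Ad_def matrix_mul_assoc)
  then show ?thesis using H by (auto simp: horizontal_def vertical_eq[OF L])
qed

lemma horizontal_vertical_zero:
  assumes L: "L \<in> LTpos" and "H \<in> horizontal f L" "H' \<in> horizontal f L" "H - H' \<in> vertical L"
  shows "H = H'"
proof -
  have LT: "H \<in> LTri" "H' \<in> LTri" using assms(2,3) by (auto simp: horizontal_def)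
  obtain d where d: "H - H' = dg d ** L" using assms(4) vertical_eq[OF L] by auto
  define x where "x = matrix_inv L ** (H - H')"
  have x: "x = Ad L d" by (simp add: x_def d Ad_def matrix_mul_assoc)
  have "Q x x = Q (matrix_inv L ** H) (Ad L d) - Q (matrix_inv L ** H') (Ad L d)"
    by (subst (2) x) (simp add: x_def mm.diff_right Q.diff_left)
  also have "\<dots> = 0" using assms(2,3) horizontal_iff[OF L] LT by simp
  finally have "x = 0" using Q_pos[OF Ad_LTri[OF L], of d] x by fastforce
  then have "d = 0" using Ad_eq_0[OF LTpos_invertible[OF L], of d] x by simp
  then show ?thesis using d by (simp add: mm.zero_left linear_0[OF linear_dg])
qed

lemma mult_omega_horizontal:
  assumes "L \<in> LTpos" "Z \<in> LTri"
  shows "L ** omega L Z \<in> horizontal f L"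
  using assms
  by (subst horizontal_iff) (auto intro!: LTri_mult omega_LTri
      simp: LTpos_LTri matrix_inv_left_mult LTpos_invertible omega_horizontal)

lemma hor_eq:
  assumes L: "L \<in> LTpos" and Z: "Z \<in> LTri"
  shows "hor f L Z = L ** omega L Z"
  unfolding hor_def
proof (rule the_equality)
  have "Z - L ** omega L Z = dg (- vcoord L Z) ** L"
    by (simp add: mult_omega[OF L] linear_neg[OF linear_dg] mm.minus_left)
  then show *: "L ** omega L Z \<in> horizontal f L \<and> Z - L ** omega L Z \<in> vertical L"
    using mult_omega_horizontal[OF L Z] by (auto simp: vertical_eq[OF L])
  show "H = L ** omega L Z" if H: "H \<in> horizontal f L \<and> Z - H \<in> vertical L" for H
  proof (rule horizontal_vertical_zero[OF L])
    obtain d where d: "Z - H = dg d ** L"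
      using H unfolding vertical_eq[OF L] by auto
    obtain e where e: "Z - L ** omega L Z = dg e ** L"
      using * unfolding vertical_eq[OF L] by auto
    have "H - L ** omega L Z = (Z - L ** omega L Z) - (Z - H)" by simp
    also have "\<dots> = dg (e - d) ** L"
      unfolding d e by (simp add: linear_diff[OF linear_dg] mm.diff_left)
    finally have "H - L ** omega L Z = dg (e - d) ** L" .
    then show "H - L ** omega L Z \<in> vertical L" by (auto simp: vertical_eq[OF L])
  qed (use H * in auto)
qed

lemma Diag_mult_LTri: "\<xi> \<in> LTri \<Longrightarrow> Diag L ** \<xi> \<in> LTri"
  unfolding Diag_eq_dg by (intro LTri_mult dg_LTri)

text \<open>As \<open>\<xi>\<close> has zero diagonal, \<open>Diag L ** \<xi>\<close> is already a
  lift of it; its horizontal part differs by a vertical vector, which \<open>d_proj L\<close>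
  kills.\<close>

lemma hor_lift_eq:
  assumes L: "L \<in> LTpos" and \<xi>: "\<xi> \<in> LT0"
  shows "hor_lift f L \<xi> = hor f L (Diag L ** \<xi>)"
  unfolding hor_lift_def
proof (rule the_equality)
  define Z where "Z = Diag L ** \<xi>"
  have Z: "Z \<in> LTri" unfolding Z_def by (intro Diag_mult_LTri LT0_LTri \<xi>)
  have "Diag \<xi> = 0" using \<xi> by (simp add: Diag_def LT0_def vec_eq_iff)
  then have "Diag Z = 0" by (simp add: Z_def Diag_eq_dg[of L] Diag_dg_mult mm.zero_right)
  then have "d_proj L Z = matrix_inv (Diag L) ** Z"
    by (simp add: d_proj_eq[OF L] mm.zero_left)
  then have dZ: "d_proj L Z = \<xi>" by (simp add: Z_def matrix_inv_left_mult Diag_invertible[OF L])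
  have "d_proj L (dg (vcoord L Z) ** L) = 0" using d_proj_zero_iff[OF L] by blast
  then have "d_proj L (L ** omega L Z) = \<xi>"
    by (simp add: mult_omega[OF L] linear_add[OF linear_d_proj[OF L]] dZ)
  then show *: "hor f L (Diag L ** \<xi>) \<in> horizontal f L \<and> d_proj L (hor f L (Diag L ** \<xi>)) = \<xi>"
    using mult_omega_horizontal[OF L Z] hor_eq[OF L Z] by (simp add: Z_def)
  show "H = hor f L (Diag L ** \<xi>)" if "H \<in> horizontal f L \<and> d_proj L H = \<xi>" for H
  proof (rule horizontal_vertical_zero[OF L])
    have "d_proj L (H - hor f L (Diag L ** \<xi>)) = 0"
      using that * by (simp add: linear_diff[OF linear_d_proj[OF L]])
    moreover have "H - hor f L (Diag L ** \<xi>) \<in> LTri"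
      using that * by (auto simp: horizontal_def intro: subspace_diff[OF subspace_LTri])
    ultimately show "H - hor f L (Diag L ** \<xi>) \<in> vertical L" by (simp add: vertical_def)
  qed (use that * in auto)
qed

text \<open>\<open>omega\<close> is built from \<open>matrix_inv q ** v\<close> and
  \<open>Ad q\<close> only, and both are invariant under the diagonal group. This makes the value in
  \<open>QLC\<close> independent of the point of the fiber.\<close>

lemma omega_dg_mult:
  assumes d: "\<And>i. d $ i \<noteq> 0" and p: "invertible p"
  shows "omega (dg d ** p) (dg d ** v) = omega p v"
proof -
  have Ad: "Ad (dg d ** p) e = Ad p e" for e by (rule Ad_dg_mult[OF d p])
  have "matrix_inv (dg d ** p) ** (dg d ** v) = matrix_inv p ** v"
    by (simp add: matrix_inv_mult dg_inv(1)[OF d] p matrix_mul_assoc[symmetric] matrix_inv_left_mult)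
  then show ?thesis by (simp add: omega_def vcoord_def gram_def Ad)
qed

lemma QLC_eq:
  assumes p: "p \<in> LT1" and x: "x \<in> LT0" and y: "y \<in> LT0"
  shows "QLC f p x y = Q (omega p x) (omega p y)"
proof -
  have "LC f L (hor_lift f L x) (hor_lift f L y) = Q (omega p x) (omega p y)"
    if L: "L \<in> LTpos" and Lp: "lt_proj L = p" for L
  proof -
    define d where "d = (\<chi> i. L $ i $ i)"
    have d: "d $ i \<noteq> 0" for i using L by (auto simp: d_def LTpos_def less_le)
    have DL: "Diag L = dg d" by (simp add: Diag_eq_dg d_def)
    have "L = dg d ** p" using Diag_mult_lt_proj[OF L] by (simp add: Lp DL)
    then have omega: "omega L (dg d ** z) = omega p z" for z
      using omega_dg_mult[OF d LTpos_invertible[OF LT1_LTpos[OF p]]] by simp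
    have lift: "hor_lift f L z = L ** omega p z" if "z \<in> LT0" for z
      using hor_lift_eq[OF L that] hor_eq[OF L Diag_mult_LTri[OF LT0_LTri[OF that]], of L] by (simp add: DL omega)
    have "L ** omega p z \<in> LTri" if "z \<in> LT0" for z
      by (intro LTri_mult omega_LTri LTpos_LTri[OF L] LT1_LTpos[OF p] LT0_LTri[OF that])
    then show ?thesis
      by (simp add: lift x y LC_eq L matrix_inv_left_mult LTpos_invertible)
  qed
  \<comment> \<open>The fiber over \<open>p\<close> contains \<open>p\<close> itself, so the
    condition on all its points determines \<open>r\<close>.\<close>
  then show ?thesis
    unfolding QLC_def using lt_proj_LT1_id[OF p] LT1_LTpos[OF p] by (intro the_equality) metis+
qed

lemma inv_LT1_diag: "p \<in> LT1 \<Longrightarrow> matrix_inv p $ i $ i = 1"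
  using LTri_mult_diag[of p "matrix_inv p" i] matrix_inv_right[OF LTpos_invertible, of p]
  by (auto simp: LT1_LTri LT1_LTpos LTpos_inv_LTri) (simp add: LT1_def mat_def)

text \<open>Conjugation by a unit triangular matrix preserves the diagonal. Thus \<open>LTri\<close>
  is the sum of \<open>LT0\<close> and the range of \<open>Ad p\<close>, and the vertical component
  of a trivialized vector is its diagonal.\<close>

lemma Ad_diag: "p \<in> LT1 \<Longrightarrow> Ad p d $ i $ i = d $ i"
  unfolding Ad_def
  by (simp add: LTri_mult_diag LTri_mult dg_LTri LT1_LTri LT1_LTpos LTpos_inv_LTri inv_LT1_diag)
    (simp add: dg_def LT1_def)

lemma inv_mult_LT0: "p \<in> LT1 \<Longrightarrow> v \<in> LT0 \<Longrightarrow> matrix_inv p ** v \<in> LT0"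
  using LTri_mult[OF LTpos_inv_LTri LT0_LTri, of p v] LTri_mult_diag[OF LTpos_inv_LTri LT0_LTri, of p v]
  by (auto simp: LT1_LTpos LT0_def)

lemma mult_LT0: "p \<in> LT1 \<Longrightarrow> v \<in> LT0 \<Longrightarrow> p ** v \<in> LT0"
  using LTri_mult[OF LT1_LTri LT0_LTri, of p v] LTri_mult_diag[OF LT1_LTri LT0_LTri, of p v]
  by (auto simp: LT0_def)

lemma omega_diag: "p \<in> LT1 \<Longrightarrow> v \<in> LT0 \<Longrightarrow> omega p v $ i $ i = vcoord p v $ i"
  using inv_mult_LT0[of p v] by (auto simp: omega_def Ad_diag LT0_def)

lemma Diag_omega: "p \<in> LT1 \<Longrightarrow> v \<in> LT0 \<Longrightarrow> Diag (omega p v) = dg (vcoord p v)"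
  by (simp add: Diag_eq_dg omega_diag)

text \<open>The vertical correction in \<open>omega p v\<close> is read off the diagonal, so the
  velocity can be recovered from \<open>omega\<close>. This is the equation of motion of the
  projected curve.\<close>

lemma velocity_omega:
  assumes "p \<in> LT1" "v \<in> LT0"
  shows "p ** omega p v - Diag (omega p v) ** p = v"
  using assms by (simp add: Diag_omega mult_omega LT1_LTpos)

lemma inv_mult_velocity:
  assumes "p \<in> LT1" "v \<in> LT0"
  shows "matrix_inv p ** v = omega p v - Ad p (vcoord p v)"
  by (simp add: omega_def)

lemma omega_differentiable:
  assumes p: "p \<in> LTpos"
  shows "(\<lambda>x. omega (fst x) (snd x)) differentiable (at (p, u))"
proof -
  note inv = LTpos_invertible[OF p]
  have fst: "(fst :: 'n sqmat \<times> 'n sqmat \<Rightarrow> _) differentiable (at (p, u))"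
    and snd: "(snd :: 'n sqmat \<times> 'n sqmat \<Rightarrow> _) differentiable (at (p, u))"
    by (intro linear_imp_differentiable linear_fst linear_snd)+
  have inv_d: "(\<lambda>x :: 'n sqmat \<times> 'n sqmat. matrix_inv (fst x)) differentiable (at (p, u))"
    using differentiable_matrix_inv[OF fst] inv by simp
  note bil = differentiable_bilinear[OF bounded_bilinear_matmul]
  have dgd: "(\<lambda>x :: 'n sqmat \<times> 'n sqmat. dg (g x)) differentiable (at (p, u))"
    if "g differentiable (at (p, u))" for g
    using differentiable_chain_at[OF that linear_imp_differentiable[OF linear_dg]] by (simp add: o_def)
  have Ad_d: "(\<lambda>x :: 'n sqmat \<times> 'n sqmat. Ad (fst x) (g x)) differentiable (at (p, u))"
    if "g differentiable (at (p, u))" for g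
    unfolding Ad_def by (intro bil inv_d dgd that fst)
  have gram_d: "(\<lambda>x :: 'n sqmat \<times> 'n sqmat. gram (fst x)) differentiable (at (p, u))"
    unfolding gram_def
    by (intro differentiable_vec_lambda differentiable_bilinear[OF bounded_bilinear_Q] Ad_d differentiable_const)
  have gram_inv_d: "(\<lambda>x :: 'n sqmat \<times> 'n sqmat. matrix_inv (gram (fst x))) differentiable (at (p, u))"
    using differentiable_matrix_inv[OF gram_d] gram_invertible[OF p] by simp
  have "(\<lambda>x :: 'n sqmat \<times> 'n sqmat. vcoord (fst x) (snd x)) differentiable (at (p, u))"
    unfolding vcoord_def
    by (intro differentiable_minus differentiable_bilinear[OF bounded_bilinear_matvec] gram_inv_d
        differentiable_vec_lambda differentiable_bilinear[OF bounded_bilinear_Q] bil inv_d snd Ad_d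
        differentiable_const)
  then show ?thesis
    unfolding omega_def by (intro differentiable_add bil inv_d snd Ad_d)
qed

end

lemma has_vector_derivative_compose_derivative:
  assumes "(x has_vector_derivative x') (at t within I)" "(F has_derivative D) (at (x t))"
  shows "((\<lambda>s. F (x s)) has_vector_derivative D x') (at t within I)"
  using has_derivative_compose[OF assms(1)[unfolded has_vector_derivative_def] assms(2)]
    linear_scale[OF has_derivative_linear[OF assms(2)]]
  by (simp add: has_vector_derivative_def)

text \<open>The inverse of the curve has derivative \<open>- N ** matrix_inv (\<gamma> t)\<close>,
  so conjugation by it differentiates to a commutator with \<open>N\<close>.\<close>

lemma has_vector_derivative_Ad:
  fixes \<gamma> :: "real \<Rightarrow> 'n::finite sqmat"
  assumes "(\<gamma> has_vector_derivative u) (at t within I)" and inv: "invertible (\<gamma> t)"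
  defines "N \<equiv> matrix_inv (\<gamma> t) ** u"
  shows "((\<lambda>s. Ad (\<gamma> s) e) has_vector_derivative Ad (\<gamma> t) e ** N - N ** Ad (\<gamma> t) e) (at t within I)"
proof -
  have "((\<lambda>s. matrix_inv (\<gamma> s) ** dg e ** \<gamma> s) has_vector_derivative
      matrix_inv (\<gamma> t) ** dg e ** u + (matrix_inv (\<gamma> t) ** 0
        + - (matrix_inv (\<gamma> t) ** u ** matrix_inv (\<gamma> t)) ** dg e) ** \<gamma> t) (at t within I)"
    by (intro has_vector_derivative_matmul has_vector_derivative_matrix_inv assms has_vector_derivative_const)
  moreover have "matrix_inv (\<gamma> t) ** dg e ** u + (matrix_inv (\<gamma> t) ** 0
      + - (matrix_inv (\<gamma> t) ** u ** matrix_inv (\<gamma> t)) ** dg e) ** \<gamma> t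
    = Ad (\<gamma> t) e ** N - N ** Ad (\<gamma> t) e"
    by (simp add: Ad_def N_def mm.zero_right mm.minus_left matrix_mul_assoc[symmetric]
        matrix_inv_right_mult inv)
  ultimately show ?thesis by (simp add: Ad_def)
qed

lemma has_vector_derivative_Diag:
  "(x has_vector_derivative x') F \<Longrightarrow> ((\<lambda>t. Diag (x t)) has_vector_derivative Diag x') F"
  by (rule bounded_linear.has_vector_derivative[OF bounded_linear_Diag])

lemma derivative_in_LTri:
  assumes "\<And>s. s \<in> I \<Longrightarrow> x s \<in> LTri" and "t \<in> I"
    and "(x has_vector_derivative x') (at t within I)" and "at t within I \<noteq> bot"
  shows "x' \<in> LTri"
  using has_vector_derivative_const_entry[OF _ assms(2-4), of _ _ 0] assms(1) by (simp add: LTri_def)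

text \<open>Used with \<open>c = 1\<close> for curves in \<open>LT1\<close> and with
  \<open>c = 0\<close> for their velocities.\<close>

lemma derivative_in_LT0:
  assumes "\<And>s. s \<in> I \<Longrightarrow> x s \<in> LTri" and "\<And>s i. s \<in> I \<Longrightarrow> x s $ i $ i = c" and "t \<in> I"
    and "(x has_vector_derivative x') (at t within I)" and "at t within I \<noteq> bot"
  shows "x' \<in> LT0"
  using has_vector_derivative_const_entry[OF _ assms(3-5), of _ _ c] assms(2)
    derivative_in_LTri[OF assms(1,3-5)] by (simp add: LT0_def)

lemma at_within_unit_interval: "(t::real) \<in> {0..1} \<Longrightarrow> at t within {0..1} \<noteq> bot"
  using islimpt_Icc[of 0 1 t] by (simp add: trivial_limit_within)

section \<open>Geodesics of the quotient metric\<close>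

context lie_cholesky
begin

text \<open>A horizontal vector is orthogonal to the vertical correction of the other argument. With
  a fixed test vector, only one factor then has to be differentiated through
  \<open>omega\<close>.\<close>

lemma Q_omega_omega: "q \<in> LTpos \<Longrightarrow> Q (omega q x) (omega q y) = Q (omega q x) (matrix_inv q ** y)"
  by (simp add: omega_def[of q y] Q.add_right omega_horizontal)

text \<open>Here \<open>Om (u, a)\<close> is the derivative of \<open>w\<close> along a curve with
  velocity \<open>u\<close> and acceleration \<open>a\<close>, so the geodesic equation is the
  Euler-Arnold equation, but tested on \<open>LT0\<close> only.\<close>

lemma QLC_christoffel_iff:
  assumes p: "p \<in> LT1" and u: "u \<in> LT0" and a: "a \<in> LT0"
    and Om: "((\<lambda>x. omega (fst x) (snd x)) has_derivative Om) (at (p, u))"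
  defines "w \<equiv> omega p u"
  shows "a = - christoffel LT0 (QLC f) p u u \<longleftrightarrow>
    (\<forall>z\<in>LT0. Q (Om (u, a)) z = Q w (w ** z - z ** w))"
proof -
  note pp = LT1_LTpos[OF p]
  note inv = LTpos_invertible[OF pp]
  define D where "D z xa = Q w (- (matrix_inv p ** fst xa ** matrix_inv p) ** z)
      + Q (Om xa) (matrix_inv p ** z)"
    for z :: "'n sqmat" and xa :: "'n sqmat \<times> 'n sqmat"
  have D: "((\<lambda>(q, v). Q (omega q v) (matrix_inv q ** z)) has_derivative D z) (at (p, u))" for z
  proof -
    have dinv: "((\<lambda>x :: 'n sqmat \<times> 'n sqmat. matrix_inv (fst x)) has_derivative
        (\<lambda>h. - (matrix_inv p ** fst h ** matrix_inv p))) (at (p, u))"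
      using has_derivative_matrix_inv[OF has_derivative_fst[OF has_derivative_ident], of "(p, u)"] inv
      by simp
    have "((\<lambda>x. Q (omega (fst x) (snd x)) (matrix_inv (fst x) ** z)) has_derivative D z) (at (p, u))"
      by (rule has_derivative_eq_rhs[OF Q.FDERIV[OF Om mm.FDERIV[OF dinv has_derivative_const]]])
        (simp add: D_def fun_eq_iff mm.zero_right w_def)
    then show ?thesis by (simp add: case_prod_beta')
  qed
  have QLC_h: "QLC f q x y = Q (omega q x) (matrix_inv q ** y)" if "q \<in> LT1" "x \<in> LT0" "y \<in> LT0" for q x y
    using that by (simp add: QLC_eq Q_omega_omega LT1_LTpos)
  have "a = - christoffel LT0 (QLC f) p u u \<longleftrightarrow> (\<forall>z\<in>LT0. 2 * D z (u, a) = D u (z, 0))"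
  proof (rule christoffel_iff[OF subspace_LT0 u a, where h = "\<lambda>q v z. Q (omega q v) (matrix_inv q ** z)"
        and b = "\<lambda>x y. Q (omega p x) (omega p y)"])
    show "bilinear (\<lambda>x y. Q (omega p x) (omega p y))"
      by (auto simp: bilinear_def linear_iff Q.add_left Q.add_right Q.scaleR_left Q.scaleR_right
          linear_add[OF linear_omega] linear_scale[OF linear_omega])
    show "0 < Q (omega p x) (omega p x)" if "x \<in> LT0" "x \<noteq> 0" for x
    proof (rule Q_pos)
      show "omega p x \<in> LTri" using pp that by (intro omega_LTri LT0_LTri)
      have "Diag (0 :: 'n sqmat) = 0" by (rule linear_0[OF linear_Diag])
      then show "omega p x \<noteq> 0"
        using velocity_omega[OF p that(1)] that(2) by (auto simp: mm.zero_right mm.zero_left)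
    qed
    show "QLC f p x y = Q (omega p x) (omega p y)" if "x \<in> LT0" "y \<in> LT0" for x y
      by (rule QLC_eq[OF p that])
    show "\<forall>\<^sub>F s in nhds 0. QLC f (p + s *\<^sub>R z) x y
        = Q (omega (p + s *\<^sub>R z) x) (matrix_inv (p + s *\<^sub>R z) ** y)"
      if "x \<in> LT0" "y \<in> LT0" "z \<in> LT0" for x y z
      by (intro always_eventually allI QLC_h LT1_line p that)
    show "linear (\<lambda>z. Q (omega q v) (matrix_inv q ** z))" for q v
      by (rule linearI) (simp_all add: Q.add_right Q.scaleR_right mm.add_right mm.scaleR_right)
  qed (rule D)
  also have "\<dots> \<longleftrightarrow> (\<forall>z\<in>LT0. Q (Om (u, a)) (matrix_inv p ** z)
      = Q w (w ** (matrix_inv p ** z) - (matrix_inv p ** z) ** w))"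
  proof (rule ball_cong[OF refl])
    fix z :: "'n sqmat" assume z: "z \<in> LT0"
    define \<zeta> where "\<zeta> = matrix_inv p ** z"
    define N where "N = matrix_inv p ** u"
    have 1: "D z (u, a) = Q (Om (u, a)) \<zeta> - Q w (N ** \<zeta>)"
      by (simp add: D_def \<zeta>_def N_def mm.minus_left matrix_mul_assoc Q.minus_right)
    \<comment> \<open>The variation of \<open>omega\<close> when the base point moves along
      \<open>z\<close> with the velocity \<open>u\<close> held fixed.\<close>
    define d where "d = Om (z, 0)"
    have q': "((\<lambda>s. p + s *\<^sub>R z) has_vector_derivative z) (at 0)"
      by (auto intro!: derivative_eq_intros)
    have line: "((\<lambda>s :: real. (p + s *\<^sub>R z, u)) has_vector_derivative (z, 0)) (at 0)"
      by (intro has_vector_derivative_Pair q' has_vector_derivative_const)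
    have w': "((\<lambda>s. omega (p + s *\<^sub>R z) u) has_vector_derivative d) (at 0)"
      using has_vector_derivative_compose_derivative[OF line, of "\<lambda>x. omega (fst x) (snd x)" Om] Om
      by (simp add: d_def)
    have "D u (z, 0) = 2 * Q w d"
    proof (rule vector_derivative_unique_at)
      show "((\<lambda>s. Q (omega (p + s *\<^sub>R z) u) (matrix_inv (p + s *\<^sub>R z) ** u)) has_vector_derivative D u (z, 0)) (at 0)"
        using has_vector_derivative_compose_derivative[OF line, of "\<lambda>(q, v). Q (omega q v) (matrix_inv q ** u)" "D u"]
          D[of u] by simp
      have "((\<lambda>s. Q (omega (p + s *\<^sub>R z) u) (omega (p + s *\<^sub>R z) u)) has_vector_derivative 2 * Q w d) (at 0)"
        using Q.has_vector_derivative[OF w' w'] Q_sym[of d w] by (simp add: w_def)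
      then show "((\<lambda>s. Q (omega (p + s *\<^sub>R z) u) (matrix_inv (p + s *\<^sub>R z) ** u)) has_vector_derivative 2 * Q w d) (at 0)"
        by (simp add: Q_omega_omega LT1_LTpos LT1_line p z)
    qed
    \<comment> \<open>Instead of the inverse Gram matrix, the identity \<open>velocity_omega\<close>
      is differentiated. It leaves the diagonal of \<open>d\<close> undetermined, but that enters
      through \<open>Ad p\<close>, which is orthogonal to \<open>w\<close>.\<close>
    moreover have "Q w d = Q w (w ** \<zeta>) - Q w (N ** \<zeta>) - Q w (\<zeta> ** w)"
    proof -
      have "((\<lambda>s. (p + s *\<^sub>R z) ** omega (p + s *\<^sub>R z) u - Diag (omega (p + s *\<^sub>R z) u) ** (p + s *\<^sub>R z))
          has_vector_derivative (p ** d + z ** w) - (Diag w ** z + Diag d ** p)) (at 0)"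
        using has_vector_derivative_diff[OF has_vector_derivative_matmul[OF q' w']
            has_vector_derivative_matmul[OF has_vector_derivative_Diag[OF w'] q']]
        by (simp add: w_def)
      moreover have "((\<lambda>s. (p + s *\<^sub>R z) ** omega (p + s *\<^sub>R z) u - Diag (omega (p + s *\<^sub>R z) u) ** (p + s *\<^sub>R z))
          has_vector_derivative 0) (at 0)"
        by (simp add: velocity_omega LT1_line p z u)
      ultimately have "(p ** d + z ** w) - (Diag w ** z + Diag d ** p) = 0"
        by (rule vector_derivative_unique_at)
      then have "p ** d = Diag w ** z + Diag d ** p - z ** w" by (simp add: algebra_simps)
      then have "matrix_inv p ** (p ** d) = matrix_inv p ** (Diag w ** z + Diag d ** p - z ** w)" by simp
      then have "d = matrix_inv p ** (Diag w ** z) + matrix_inv p ** (Diag d ** p) - \<zeta> ** w"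
        by (simp add: matrix_inv_left_mult inv mm.add_right mm.diff_right \<zeta>_def matrix_mul_assoc[symmetric])
      moreover have "matrix_inv p ** (Diag d ** p) = Ad p (\<chi> i. d $ i $ i)"
        by (simp add: Ad_def Diag_eq_dg matrix_mul_assoc)
      \<comment> \<open>The difference \<open>w - N\<close> is the vertical part of
        \<open>w\<close>, the conjugate of its diagonal. The terms with \<open>N\<close> cancel in
        the final equation.\<close>
      moreover have "matrix_inv p ** (Diag w ** z) = (w - N) ** \<zeta>"
      proof -
        have "Diag w = dg (vcoord p u)" by (simp add: w_def Diag_omega[OF p u])
        then have "w - N = matrix_inv p ** Diag w ** p"
          by (simp add: w_def N_def omega_def[of p u] Ad_def)
        then show ?thesis
          by (simp add: \<zeta>_def matrix_mul_assoc[symmetric] matrix_inv_right_mult inv)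
      qed
      ultimately have "d = (w - N) ** \<zeta> + Ad p (\<chi> i. d $ i $ i) - \<zeta> ** w" by simp
      then have "Q w d = Q w ((w - N) ** \<zeta> + Ad p (\<chi> i. d $ i $ i) - \<zeta> ** w)" by simp
      then show ?thesis
        by (simp add: Q.add_right Q.diff_right mm.diff_left omega_horizontal[OF pp] w_def)
    qed
    ultimately show "2 * D z (u, a) = D u (z, 0) \<longleftrightarrow> Q (Om (u, a)) (matrix_inv p ** z)
        = Q w (w ** (matrix_inv p ** z) - (matrix_inv p ** z) ** w)"
      unfolding \<zeta>_def[symmetric] 1 by (auto simp: Q.diff_right)
  qed
  also have "\<dots> \<longleftrightarrow> (\<forall>z\<in>LT0. Q (Om (u, a)) z = Q w (w ** z - z ** w))"
  proof
    assume *: "\<forall>z\<in>LT0. Q (Om (u, a)) (matrix_inv p ** z)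
      = Q w (w ** (matrix_inv p ** z) - (matrix_inv p ** z) ** w)"
    show "\<forall>z\<in>LT0. Q (Om (u, a)) z = Q w (w ** z - z ** w)"
    proof
      fix z :: "'n sqmat" assume "z \<in> LT0"
      then show "Q (Om (u, a)) z = Q w (w ** z - z ** w)"
        using bspec[OF *, of "p ** z"] by (simp add: matrix_inv_left_mult inv mult_LT0 p)
    qed
  qed (use p in \<open>auto simp: inv_mult_LT0\<close>)
  finally show ?thesis .
qed

text \<open>Horizontality identifies \<open>w t\<close> with
  \<open>omega (\<Gamma> t) (\<Gamma>' t)\<close>, its vertical part being given by its diagonal.
  The Euler-Arnold equation holds on \<open>LTri\<close> and a fortiori on
  \<open>LT0\<close>.\<close>

lemma QLC_geodesicI:
  assumes \<Gamma>: "\<And>t. t \<in> I \<Longrightarrow> \<Gamma> t \<in> LT1"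
    and w_LT: "\<And>t. t \<in> I \<Longrightarrow> w t \<in> LTri"
    and \<Gamma>': "\<And>t. t \<in> I \<Longrightarrow> (\<Gamma> has_vector_derivative \<Gamma> t ** w t - Diag (w t) ** \<Gamma> t) (at t within I)"
    and w': "\<And>t. t \<in> I \<Longrightarrow> (w has_vector_derivative euler_arnold (w t) (w t)) (at t within I)"
    and hz: "\<And>t e. t \<in> I \<Longrightarrow> Q (w t) (Ad (\<Gamma> t) e) = 0"
    and nt: "\<And>t. t \<in> I \<Longrightarrow> at t within I \<noteq> bot"
  shows "is_geodesic LT0 LT1 (QLC f) I \<Gamma>"
proof -
  define u where "u t = \<Gamma> t ** w t - Diag (w t) ** \<Gamma> t" for t
  define a where "a t = (\<Gamma> t ** euler_arnold (w t) (w t) + u t ** w t)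
      - (Diag (w t) ** u t + Diag (euler_arnold (w t) (w t)) ** \<Gamma> t)" for t
  have u': "(u has_vector_derivative a t) (at t within I)" if t: "t \<in> I" for t
    unfolding u_def[abs_def] a_def
    by (intro has_vector_derivative_diff has_vector_derivative_matmul has_vector_derivative_Diag w'[OF t]
        \<Gamma>'[OF t])
  have \<Gamma>d: "\<Gamma> t $ i $ i = 1" if "t \<in> I" for t i using \<Gamma>[OF that] by (simp add: LT1_def)
  have u_LT0: "u t \<in> LT0" if t: "t \<in> I" for t
    by (rule derivative_in_LT0[OF _ \<Gamma>d t \<Gamma>'[OF t, folded u_def] nt[OF t]]) (use \<Gamma> LT1_LTri in auto)
  have a_LT0: "a t \<in> LT0" if t: "t \<in> I" for t
    by (rule derivative_in_LT0[OF _ _ t u'[OF t] nt[OF t], where c = 0])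
      (use u_LT0 in \<open>auto simp: LT0_def\<close>)
  have omega: "omega (\<Gamma> t) (u t) = w t" if t: "t \<in> I" for t
  proof (rule omega_eqI[OF LT1_LTpos[OF \<Gamma>[OF t]] _ hz[OF t]])
    show "w t = matrix_inv (\<Gamma> t) ** u t + Ad (\<Gamma> t) (\<chi> i. w t $ i $ i)"
      by (simp add: u_def Ad_def Diag_eq_dg mm.diff_right matrix_inv_left_mult matrix_mul_assoc[symmetric]
          LTpos_invertible LT1_LTpos \<Gamma> t)
  qed
  show ?thesis
    unfolding is_geodesic_def
  proof (intro conjI ballI exI[of _ u])
    fix t assume t: "t \<in> I"
    show "\<Gamma> t \<in> LT1" "(\<Gamma> has_vector_derivative u t) (at t within I)"
      using \<Gamma> \<Gamma>' t by (auto simp: u_def)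
    obtain Om where Om: "((\<lambda>x. omega (fst x) (snd x)) has_derivative Om) (at (\<Gamma> t, u t))"
      using omega_differentiable[OF LT1_LTpos[OF \<Gamma>[OF t]]] unfolding differentiable_def by blast
    have "((\<lambda>s. omega (\<Gamma> s) (u s)) has_vector_derivative Om (u t, a t)) (at t within I)"
      using has_vector_derivative_compose_derivative[OF has_vector_derivative_Pair[OF
          \<Gamma>'[OF t, folded u_def] u'[OF t]] Om] by simp
    moreover have "((\<lambda>s. omega (\<Gamma> s) (u s)) has_vector_derivative euler_arnold (w t) (w t)) (at t within I)"
      by (rule has_vector_derivative_transform[OF t _ w'[OF t]]) (simp add: omega)
    ultimately have "Om (u t, a t) = euler_arnold (w t) (w t)"
      using vector_derivative_unique_within[OF nt[OF t]] by blast
    then have "a t = - christoffel LT0 (QLC f) (\<Gamma> t) (u t) (u t)"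
      unfolding QLC_christoffel_iff[OF \<Gamma>[OF t] u_LT0[OF t] a_LT0[OF t] Om]
      by (simp add: omega t Q_euler_arnold LT0_LTri)
    then show "(u has_vector_derivative - christoffel LT0 (QLC f) (\<Gamma> t) (u t) (u t)) (at t within I)"
      using u'[OF t] by simp
  qed
qed

text \<open>The Euler-Lagrange equation for the quotient metric only tests against \<^term>\<open>LT0\<close>. Differentiating the
  horizontality of \<open>w\<close> gives it on the remaining directions \<^term>\<open>Ad (\<Gamma> t) e\<close>.\<close>

lemma QLC_geodesicD:
  assumes "is_geodesic LT0 LT1 (QLC f) I \<Gamma>" and nt: "\<And>t. t \<in> I \<Longrightarrow> at t within I \<noteq> bot"
  shows "\<exists>w. \<forall>t\<in>I. \<Gamma> t \<in> LT1
    \<and> (\<Gamma> has_vector_derivative \<Gamma> t ** w t - Diag (w t) ** \<Gamma> t) (at t within I)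
    \<and> w t = omega (\<Gamma> t) (\<Gamma> t ** w t - Diag (w t) ** \<Gamma> t)
    \<and> (w has_vector_derivative euler_arnold (w t) (w t)) (at t within I)"
proof -
  from assms(1) obtain u where \<Gamma>: "\<And>t. t \<in> I \<Longrightarrow> \<Gamma> t \<in> LT1"
    and \<Gamma>': "\<And>t. t \<in> I \<Longrightarrow> (\<Gamma> has_vector_derivative u t) (at t within I)"
    and u': "\<And>t. t \<in> I \<Longrightarrow> (u has_vector_derivative - christoffel LT0 (QLC f) (\<Gamma> t) (u t) (u t)) (at t within I)"
    unfolding is_geodesic_def by blast
  define a where "a t = - christoffel LT0 (QLC f) (\<Gamma> t) (u t) (u t)" for t
  define w where "w t = omega (\<Gamma> t) (u t)" for t
  have \<Gamma>d: "\<Gamma> t $ i $ i = 1" if "t \<in> I" for t i using \<Gamma>[OF that] by (simp add: LT1_def)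
  have u_LT0: "u t \<in> LT0" if t: "t \<in> I" for t
    by (rule derivative_in_LT0[OF _ \<Gamma>d t \<Gamma>'[OF t] nt[OF t]]) (use \<Gamma> LT1_LTri in auto)
  have a_LT0: "a t \<in> LT0" if t: "t \<in> I" for t
    unfolding a_def
    by (rule derivative_in_LT0[OF _ _ t u'[OF t] nt[OF t], where c = 0])
      (use u_LT0 in \<open>auto simp: LT0_def\<close>)
  have u_eq: "u t = \<Gamma> t ** w t - Diag (w t) ** \<Gamma> t" if "t \<in> I" for t
    using velocity_omega[OF \<Gamma> u_LT0, OF that that] by (simp add: w_def)
  have w_LT: "w t \<in> LTri" if "t \<in> I" for t
    unfolding w_def by (intro omega_LTri LT1_LTpos LT0_LTri \<Gamma> u_LT0 that)
  have w': "(w has_vector_derivative euler_arnold (w t) (w t)) (at t within I)" if t: "t \<in> I" for t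
  proof -
    let ?p = "\<Gamma> t"
    note p = \<Gamma>[OF t] and pp = LT1_LTpos[OF \<Gamma>[OF t]]
    obtain Om where Om: "((\<lambda>x. omega (fst x) (snd x)) has_derivative Om) (at (?p, u t))"
      using omega_differentiable[OF pp] unfolding differentiable_def by blast
    define w' where "w' = Om (u t, a t)"
    have w': "(w has_vector_derivative w') (at t within I)"
      using has_vector_derivative_compose_derivative[OF has_vector_derivative_Pair[OF
          \<Gamma>'[OF t] u'[OF t, folded a_def]] Om] by (simp add: w_def[abs_def] w'_def)
    have w'_LT: "w' \<in> LTri" by (rule derivative_in_LTri[OF w_LT t w' nt[OF t]])
    have EL: "Q w' z = Q (w t) (w t ** z - z ** w t)" if "z \<in> LT0" for z
      using QLC_christoffel_iff[OF p u_LT0[OF t] a_LT0[OF t] Om] that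
      by (simp add: a_def w'_def w_def)
    define N where "N = matrix_inv ?p ** u t"
    have N: "N = w t - Ad ?p (vcoord ?p (u t))"
      unfolding N_def w_def by (rule inv_mult_velocity[OF p u_LT0[OF t]])
    have Ad_eq: "Q w' (Ad ?p e) = Q (w t) (w t ** Ad ?p e - Ad ?p e ** w t)" for e
    proof -
      have "((\<lambda>s. Q (w s) (Ad (\<Gamma> s) e)) has_vector_derivative
          Q (w t) (Ad ?p e ** N - N ** Ad ?p e) + Q w' (Ad ?p e)) (at t within I)"
        unfolding N_def
        by (rule Q.has_vector_derivative[OF w' has_vector_derivative_Ad[OF \<Gamma>'[OF t] LTpos_invertible[OF pp]]])
      moreover have "((\<lambda>s. Q (w s) (Ad (\<Gamma> s) e)) has_vector_derivative 0) (at t within I)"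
        by (rule has_vector_derivative_transform[OF t _ has_vector_derivative_const[of 0]])
          (simp add: w_def omega_horizontal LT1_LTpos \<Gamma>)
      ultimately have "Q (w t) (Ad ?p e ** N - N ** Ad ?p e) + Q w' (Ad ?p e) = 0"
        using vector_derivative_unique_within[OF nt[OF t]] by blast
      \<comment> \<open>\<open>N\<close> differs from \<open>w t\<close> by a vertical vector, which
        commutes with \<open>Ad ?p e\<close>.\<close>
      moreover have "Ad ?p e ** N - N ** Ad ?p e = - (w t ** Ad ?p e - Ad ?p e ** w t)"
        using Ad_commute[OF LTpos_invertible[OF pp], of e "vcoord ?p (u t)"]
        by (simp add: N mm.diff_left mm.diff_right)
      ultimately show ?thesis by (simp add: Q.diff_right)
    qed
    have "euler_arnold (w t) (w t) = w'"
    proof (rule euler_arnold_eqI[OF w'_LT])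
      fix z :: "'n sqmat" assume z: "z \<in> LTri"
      \<comment> \<open>Subtracting the conjugate of its own diagonal brings \<open>z\<close> into
        \<open>LT0\<close>, so the two partial equations add up to the full one.\<close>
      define e where "e = (\<chi> i. z $ i $ i)"
      have "z - Ad ?p e \<in> LT0"
        using subspace_diff[OF subspace_LTri z Ad_LTri[OF pp, of e]] by (simp add: LT0_def Ad_diag p e_def)
      then have "Q w' ((z - Ad ?p e) + Ad ?p e)
        = Q (w t) (w t ** ((z - Ad ?p e) + Ad ?p e) - ((z - Ad ?p e) + Ad ?p e) ** w t)"
        using EL[of "z - Ad ?p e"] Ad_eq[of e]
        by (simp only: Q.add_right Q.diff_right mm.add_left mm.add_right)
      then show "Q w' z = Q (w t) (w t ** z - z ** w t)" by simp
    qed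
    with w' show ?thesis by simp
  qed
  show ?thesis
  proof (intro exI[of _ w] ballI conjI)
    fix t assume t: "t \<in> I"
    show "\<Gamma> t \<in> LT1" by (rule \<Gamma>[OF t])
    show "(w has_vector_derivative euler_arnold (w t) (w t)) (at t within I)" by (rule w'[OF t])
    show "(\<Gamma> has_vector_derivative \<Gamma> t ** w t - Diag (w t) ** \<Gamma> t) (at t within I)"
      using \<Gamma>'[OF t] unfolding u_eq[OF t] .
    show "w t = omega (\<Gamma> t) (\<Gamma> t ** w t - Diag (w t) ** \<Gamma> t)"
      unfolding u_eq[OF t, symmetric] by (rule w_def)
  qed
qed

text \<open>The acceleration of \<open>w\<close> contributes the bracket of \<open>w t\<close> with
  \<open>Ad (\<Gamma> t) e\<close>; the motion of \<open>Ad (\<Gamma> t) e\<close> contributes its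
  negative, the vertical part of \<open>w t\<close> commuting away.\<close>

lemma horizontal_momentum_conserved:
  assumes \<Gamma>: "\<And>t. \<Gamma> t \<in> LT1" and w: "\<And>t. (w has_vector_derivative euler_arnold (w t) (w t)) (at t)"
    and \<Gamma>': "\<And>t. (\<Gamma> has_vector_derivative \<Gamma> t ** w t - Diag (w t) ** \<Gamma> t) (at t)"
    and 0: "Q (w 0) (Ad (\<Gamma> 0) e) = 0"
  shows "Q (w t) (Ad (\<Gamma> t) e) = 0"
proof -
  have "((\<lambda>t. Q (w t) (Ad (\<Gamma> t) e)) has_real_derivative 0) (at t)" for t
  proof -
    note inv = LTpos_invertible[OF LT1_LTpos[OF \<Gamma>[of t]]]
    define N where "N = matrix_inv (\<Gamma> t) ** (\<Gamma> t ** w t - Diag (w t) ** \<Gamma> t)"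
    have N: "N = w t - Ad (\<Gamma> t) (\<chi> i. w t $ i $ i)"
      by (simp add: N_def Ad_def Diag_eq_dg mm.diff_right matrix_inv_left_mult inv matrix_mul_assoc[symmetric])
    have "((\<lambda>s. Q (w s) (Ad (\<Gamma> s) e)) has_vector_derivative
          Q (w t) (Ad (\<Gamma> t) e ** N - N ** Ad (\<Gamma> t) e) + Q (euler_arnold (w t) (w t)) (Ad (\<Gamma> t) e)) (at t)"
      unfolding N_def
      by (rule Q.has_vector_derivative[OF w has_vector_derivative_Ad[OF \<Gamma>' inv]])
    moreover have "Ad (\<Gamma> t) e ** N - N ** Ad (\<Gamma> t) e = - (w t ** Ad (\<Gamma> t) e - Ad (\<Gamma> t) e ** w t)"
      using Ad_commute[OF inv, of e "\<chi> i. w t $ i $ i"] by (simp add: N mm.diff_left mm.diff_right)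
    ultimately show ?thesis
      unfolding has_real_derivative_iff_has_vector_derivative
      by (simp add: Q_euler_arnold Ad_LTri LT1_LTpos \<Gamma> Q.diff_right)
  qed
  then show ?thesis using DERIV_isconst_all[of "\<lambda>t. Q (w t) (Ad (\<Gamma> t) e)" t 0] 0 by simp
qed

text \<open>A single solution of the Euler-Arnold equation drives both geodesics, so the projection
  statement and global existence come together.\<close>

lemma horizontal_geodesic_exists:
  assumes p: "p \<in> LT1" and v: "v \<in> LT0"
  shows "\<exists>L. is_geodesic LTri LTpos (LC f) UNIV L \<and> L 0 = p
    \<and> (L has_vector_derivative p ** omega p v) (at 0)
    \<and> is_geodesic LT0 LT1 (QLC f) UNIV (\<lambda>t. lt_proj (L t))
    \<and> ((\<lambda>t. lt_proj (L t)) has_vector_derivative v) (at 0)"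
proof -
  note pp = LT1_LTpos[OF p]
  obtain w R where w0: "w 0 = omega p v" and w_LT: "\<And>t. w t \<in> LTri" and w_bd: "\<And>t. norm (w t) \<le> R"
    and w': "\<And>t. (w has_vector_derivative euler_arnold (w t) (w t)) (at t)"
    using euler_arnold_flow[OF omega_LTri[OF pp LT0_LTri[OF v]]] by blast
  have "continuous_on UNIV w"
    by (meson w' continuous_at_imp_continuous_on has_vector_derivative_continuous)
  from reconstruction_exists[OF this w_LT w_bd pp]
  obtain L where L0: "L 0 = p" and L: "\<And>t. L t \<in> LTpos"
    and L': "\<And>t. (L has_vector_derivative L t ** w t) (at t)"
    by blast
  define \<Gamma> where "\<Gamma> t = lt_proj (L t)" for t
  have \<Gamma>0: "\<Gamma> 0 = p" by (simp add: \<Gamma>_def L0 lt_proj_LT1_id p)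
  have \<Gamma>: "\<Gamma> t \<in> LT1" for t unfolding \<Gamma>_def by (rule lt_proj_LT1[OF L])
  have \<Gamma>': "(\<Gamma> has_vector_derivative \<Gamma> t ** w t - Diag (w t) ** \<Gamma> t) (at t)" for t
  proof -
    \<comment> \<open>On triangular matrices \<open>Diag\<close> is multiplicative, so the factor
      \<open>Diag (L t)\<close> cancels and only \<open>\<Gamma> t\<close> and \<open>w t\<close>
      remain.\<close>
    have "Diag (L t ** w t) = Diag (L t) ** Diag (w t)"
      by (simp add: Diag_eq_dg dg_mult_dg LTri_mult_diag LTpos_LTri L w_LT)
    then have "matrix_inv (Diag (L t)) ** (L t ** w t - Diag (L t ** w t) ** lt_proj (L t))
      = \<Gamma> t ** w t - Diag (w t) ** \<Gamma> t"
      by (simp add: \<Gamma>_def mm.diff_right matrix_mul_assoc[symmetric] matrix_inv_left_mult Diag_invertible L)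
        (simp add: lt_proj_def matrix_mul_assoc)
    then show ?thesis
      using has_vector_derivative_compose_derivative[OF L'[of t] has_derivative_lt_proj[OF L]]
      by (simp add: \<Gamma>_def[abs_def])
  qed
  have "Q (w t) (Ad (\<Gamma> t) e) = 0" for t e
    by (rule horizontal_momentum_conserved[OF \<Gamma> w' \<Gamma>']) (simp add: w0 \<Gamma>0 omega_horizontal pp)
  then have "is_geodesic LT0 LT1 (QLC f) UNIV \<Gamma>"
    by (intro QLC_geodesicI[where w = w] \<Gamma> w_LT \<Gamma>' w') auto
  moreover have "is_geodesic LTri LTpos (LC f) UNIV L"
    by (intro LC_geodesicI[where w = w] L w_LT L' w')
  moreover have "(\<Gamma> has_vector_derivative v) (at 0)"
    using \<Gamma>'[of 0] velocity_omega[OF p v] by (simp add: \<Gamma>0 w0)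
  ultimately show ?thesis
    using L0 L'[of 0] w0 unfolding \<Gamma>_def[abs_def] by auto
qed

section \<open>Exponential maps and completeness\<close>

lemma is_geodesic_unit_interval:
  "is_geodesic V S g UNIV \<gamma> \<Longrightarrow> is_geodesic V S g {0..1} \<gamma>"
  unfolding is_geodesic_def by (meson UNIV_I has_vector_derivative_at_within)

text \<open>The system is triangular: \<open>w\<close> obeys a closed equation and is determined
  first, after which the curve solves a linear equation with known coefficients. Uniqueness is what
  allows the description \<open>riem_exp\<close> to be evaluated.\<close>

lemma LC_exp_unique:
  assumes p: "p \<in> LTpos" and "has_riem_exp LTri LTpos (LC f) p v q1" "has_riem_exp LTri LTpos (LC f) p v q2"
  shows "q1 = q2"
proof -
  have ex: "\<exists>L w. L 0 = p \<and> L 1 = q \<and> w 0 = matrix_inv p ** v \<and>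
      (\<forall>t\<in>{0..1}. (L has_vector_derivative L t ** w t) (at t within {0..1})
        \<and> (w has_vector_derivative euler_arnold (w t) (w t)) (at t within {0..1}))"
    if hq: "has_riem_exp LTri LTpos (LC f) p v q" for q
  proof -
    obtain L where geo: "is_geodesic LTri LTpos (LC f) {0..1} L" and L0: "L 0 = p"
      and v: "(L has_vector_derivative v) (at 0 within {0..1})" and L1: "L 1 = q"
      using hq unfolding has_riem_exp_def by blast
    obtain w where w: "\<forall>t\<in>{0..1}. L t \<in> LTpos \<and> (L has_vector_derivative L t ** w t) (at t within {0..1})
        \<and> (w has_vector_derivative euler_arnold (w t) (w t)) (at t within {0..1})"
      using LC_geodesicD[OF geo at_within_unit_interval] by blast
    have "v = p ** w 0"
      using vector_derivative_unique_within[OF at_within_unit_interval[of 0] v, of "p ** w 0"] w L0 by auto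
    then have "w 0 = matrix_inv p ** v" by (simp add: matrix_inv_left_mult LTpos_invertible p)
    with w L0 L1 show ?thesis by blast
  qed
  obtain L1 w1 where 1: "L1 0 = p" "L1 1 = q1" "w1 0 = matrix_inv p ** v"
      "\<And>t. t \<in> {0..1} \<Longrightarrow> (L1 has_vector_derivative L1 t ** w1 t) (at t within {0..1})"
      "\<And>t. t \<in> {0..1} \<Longrightarrow> (w1 has_vector_derivative euler_arnold (w1 t) (w1 t)) (at t within {0..1})"
    using ex[OF assms(2)] by blast
  obtain L2 w2 where 2: "L2 0 = p" "L2 1 = q2" "w2 0 = matrix_inv p ** v"
      "\<And>t. t \<in> {0..1} \<Longrightarrow> (L2 has_vector_derivative L2 t ** w2 t) (at t within {0..1})"
      "\<And>t. t \<in> {0..1} \<Longrightarrow> (w2 has_vector_derivative euler_arnold (w2 t) (w2 t)) (at t within {0..1})"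
    using ex[OF assms(3)] by blast
  have w_eq: "w1 t = w2 t" if "t \<in> {0..1}" for t
    by (rule euler_arnold_unique[OF 1(5) 2(5)]) (use 1(3) 2(3) that in auto)
  have "L1 1 = L2 1"
  proof (rule linear_ode_unique[where h = "\<lambda>x y. x ** y" and w = w1 and B = "\<lambda>_. 0"])
    show "(L2 has_vector_derivative L2 t ** w1 t) (at t within {0..1})" if "t \<in> {0..1}" for t
      using 2(4)[OF that] by (simp add: w_eq[OF that])
    show "continuous_on {0..1} w1"
      unfolding continuous_on_eq_continuous_within
      using 1(5) has_vector_derivative_continuous by blast
  qed (use 1 2 in \<open>auto simp: mm.zero_left\<close>)
  then show ?thesis using 1 2 by simp
qed

lemma QLC_exp_unique:
  assumes p: "p \<in> LT1" and "has_riem_exp LT0 LT1 (QLC f) p v q1" "has_riem_exp LT0 LT1 (QLC f) p v q2"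
  shows "q1 = q2"
proof -
  have ex: "\<exists>L w. L 0 = p \<and> L 1 = q \<and> w 0 = omega p v \<and>
      (\<forall>t\<in>{0..1}. (L has_vector_derivative L t ** w t - Diag (w t) ** L t) (at t within {0..1})
        \<and> (w has_vector_derivative euler_arnold (w t) (w t)) (at t within {0..1}))"
    if hq: "has_riem_exp LT0 LT1 (QLC f) p v q" for q
  proof -
    obtain L where geo: "is_geodesic LT0 LT1 (QLC f) {0..1} L" and L0: "L 0 = p"
      and v: "(L has_vector_derivative v) (at 0 within {0..1})" and L1: "L 1 = q"
      using hq unfolding has_riem_exp_def by blast
    obtain w where w: "\<forall>t\<in>{0..1}. L t \<in> LT1
        \<and> (L has_vector_derivative L t ** w t - Diag (w t) ** L t) (at t within {0..1})
        \<and> w t = omega (L t) (L t ** w t - Diag (w t) ** L t)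
        \<and> (w has_vector_derivative euler_arnold (w t) (w t)) (at t within {0..1})"
      using QLC_geodesicD[OF geo at_within_unit_interval] by blast
    have "v = p ** w 0 - Diag (w 0) ** p"
      using vector_derivative_unique_within[OF at_within_unit_interval[of 0] v,
          of "p ** w 0 - Diag (w 0) ** p"] w L0 by auto
    moreover have "w 0 = omega (L 0) (L 0 ** w 0 - Diag (w 0) ** L 0)" using w by simp
    ultimately have "w 0 = omega p v" by (simp add: L0)
    with w L0 L1 show ?thesis by blast
  qed
  obtain L1 w1 where 1: "L1 0 = p" "L1 1 = q1" "w1 0 = omega p v"
      "\<And>t. t \<in> {0..1} \<Longrightarrow> (L1 has_vector_derivative L1 t ** w1 t - Diag (w1 t) ** L1 t) (at t within {0..1})"
      "\<And>t. t \<in> {0..1} \<Longrightarrow> (w1 has_vector_derivative euler_arnold (w1 t) (w1 t)) (at t within {0..1})"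
    using ex[OF assms(2)] by blast
  obtain L2 w2 where 2: "L2 0 = p" "L2 1 = q2" "w2 0 = omega p v"
      "\<And>t. t \<in> {0..1} \<Longrightarrow> (L2 has_vector_derivative L2 t ** w2 t - Diag (w2 t) ** L2 t) (at t within {0..1})"
      "\<And>t. t \<in> {0..1} \<Longrightarrow> (w2 has_vector_derivative euler_arnold (w2 t) (w2 t)) (at t within {0..1})"
    using ex[OF assms(3)] by blast
  have w_eq: "w1 t = w2 t" if "t \<in> {0..1}" for t
    by (rule euler_arnold_unique[OF 1(5) 2(5)]) (use 1(3) 2(3) that in auto)
  have "L1 1 = L2 1"
  proof (rule linear_ode_unique[where h = "\<lambda>x y. x ** y - Diag y ** x" and w = w1 and B = Diag])
    show "(L2 has_vector_derivative L2 t ** w1 t - Diag (w1 t) ** L2 t) (at t within {0..1})"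
      if "t \<in> {0..1}" for t
      using 2(4)[OF that] by (simp add: w_eq[OF that])
    show "continuous_on {0..1} w1"
      unfolding continuous_on_eq_continuous_within
      using 1(5) has_vector_derivative_continuous by blast
  qed (use 1 2 bounded_linear_Diag in auto)
  then show ?thesis using 1 2 by simp
qed

lemma QLC_exp:
  assumes p: "p \<in> LT1" and v: "v \<in> LT0"
  defines "h \<equiv> p ** omega p v"
  shows "h \<in> riem_exp_domain LTri LTpos (LC f) p"
    and "v \<in> riem_exp_domain LT0 LT1 (QLC f) p"
    and "riem_exp LT0 LT1 (QLC f) p v = lt_proj (riem_exp LTri LTpos (LC f) p h)"
proof -
  note pp = LT1_LTpos[OF p]
  obtain L where L: "is_geodesic LTri LTpos (LC f) UNIV L" "L 0 = p"
      "(L has_vector_derivative h) (at 0)"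
      "is_geodesic LT0 LT1 (QLC f) UNIV (\<lambda>t. lt_proj (L t))"
      "((\<lambda>t. lt_proj (L t)) has_vector_derivative v) (at 0)"
    using horizontal_geodesic_exists[OF p v] unfolding h_def by blast
  have LC: "has_riem_exp LTri LTpos (LC f) p h (L 1)"
    unfolding has_riem_exp_def
    using is_geodesic_unit_interval[OF L(1)] L(2) has_vector_derivative_at_within[OF L(3)] by blast
  have QLC: "has_riem_exp LT0 LT1 (QLC f) p v (lt_proj (L 1))"
    unfolding has_riem_exp_def
    using is_geodesic_unit_interval[OF L(4)] L(2) has_vector_derivative_at_within[OF L(5)]
    by (intro exI[of _ "\<lambda>t. lt_proj (L t)"]) (simp add: lt_proj_LT1_id p)
  have "h \<in> LTri" unfolding h_def by (intro LTri_mult omega_LTri LT1_LTri p pp LT0_LTri v)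
  then show "h \<in> riem_exp_domain LTri LTpos (LC f) p"
    and "v \<in> riem_exp_domain LT0 LT1 (QLC f) p"
    using LC QLC v unfolding riem_exp_domain_def by blast+
  have "riem_exp LTri LTpos (LC f) p h = L 1"
    unfolding riem_exp_def using LC LC_exp_unique[OF pp] by (intro the_equality) auto
  moreover have "riem_exp LT0 LT1 (QLC f) p v = lt_proj (L 1)"
    unfolding riem_exp_def using QLC QLC_exp_unique[OF p] by (intro the_equality) auto
  ultimately show "riem_exp LT0 LT1 (QLC f) p v = lt_proj (riem_exp LTri LTpos (LC f) p h)" by simp
qed

lemma QLC_complete: "geodesically_complete LT0 LT1 (QLC f)"
  unfolding geodesically_complete_def
proof (intro ballI)
  fix p v :: "'n sqmat" assume p: "p \<in> LT1" and v: "v \<in> LT0"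
  obtain L where "L 0 = p" "is_geodesic LT0 LT1 (QLC f) UNIV (\<lambda>t. lt_proj (L t))"
      "((\<lambda>t. lt_proj (L t)) has_vector_derivative v) (at 0)"
    using horizontal_geodesic_exists[OF p v] by blast
  then show "\<exists>\<gamma>. is_geodesic LT0 LT1 (QLC f) UNIV \<gamma> \<and> \<gamma> 0 = p \<and> (\<gamma> has_vector_derivative v) (at 0)"
    by (intro exI[of _ "\<lambda>t. lt_proj (L t)"]) (simp add: lt_proj_LT1_id p)
qed

end

theorem lemma3p10:
  fixes f :: "'n::{finite,linorder} sqmat \<Rightarrow> 'n sqmat"
  assumes f_LT: "\<forall>Z\<in>LTri. f Z \<in> LTri"
    and f_add: "\<forall>Z\<in>LTri. \<forall>W\<in>LTri. f (Z + W) = f Z + f W"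
    and f_scale: "\<forall>c::real. \<forall>Z\<in>LTri. f (c *\<^sub>R Z) = c *\<^sub>R f Z"
    and f_self_adjoint: "\<forall>Z\<in>LTri. \<forall>W\<in>LTri. lt_inner (f Z) W = lt_inner Z (f W)"
    and f_pos_def: "\<forall>Z\<in>LTri. Z \<noteq> 0 \<longrightarrow> lt_inner (f Z) Z > 0"
  shows "(\<forall>L\<in>LTpos. \<forall>\<Gamma>. \<Gamma> = matrix_inv (Diag L) ** L \<longrightarrow>
            (\<forall>\<xi>\<in>LT0. \<forall>t::real.
               hor_lift f L \<xi> = hor f L (Diag L ** \<xi>) \<and>
               QLC f \<Gamma> \<xi> \<xi> =
                 lt_inner (f (matrix_inv \<Gamma> ** hor f \<Gamma> \<xi>)) (matrix_inv \<Gamma> ** hor f \<Gamma> \<xi>) \<and>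
               t *\<^sub>R hor f \<Gamma> \<xi> \<in> riem_exp_domain LTri LTpos (LC f) \<Gamma> \<and>
               t *\<^sub>R \<xi> \<in> riem_exp_domain LT0 LT1 (QLC f) \<Gamma> \<and>
               riem_exp LT0 LT1 (QLC f) \<Gamma> (t *\<^sub>R \<xi>) =
                 matrix_inv (Diag (riem_exp LTri LTpos (LC f) \<Gamma> (t *\<^sub>R hor f \<Gamma> \<xi>)))
                   ** riem_exp LTri LTpos (LC f) \<Gamma> (t *\<^sub>R hor f \<Gamma> \<xi>))) \<and>
         geodesically_complete LT0 LT1 (QLC f)"
proof -
  interpret lie_cholesky f
    using assms by unfold_locales
  show ?thesis
  proof (intro conjI ballI allI impI QLC_complete)
    fix L \<Gamma> \<xi> :: "'n sqmat" and t :: real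
    assume L: "L \<in> LTpos" and "\<Gamma> = matrix_inv (Diag L) ** L" and \<xi>: "\<xi> \<in> LT0"
    then have \<Gamma>: "\<Gamma> \<in> LT1" using lt_proj_LT1[OF L] by (simp add: lt_proj_def)
    have t\<xi>: "t *\<^sub>R \<xi> \<in> LT0" by (rule subspace_scale[OF subspace_LT0 \<xi>])
    have hor: "hor f \<Gamma> \<xi> = \<Gamma> ** omega \<Gamma> \<xi>" by (rule hor_eq[OF LT1_LTpos[OF \<Gamma>] LT0_LTri[OF \<xi>]])
    \<comment> \<open>By linearity \<open>omega\<close> absorbs the factor \<open>t\<close>, so the
      claim for \<open>t\<close> is the time-one claim for the vector
      \<open>t *\<^sub>R \<xi>\<close>.\<close>
    then have thor: "t *\<^sub>R hor f \<Gamma> \<xi> = \<Gamma> ** omega \<Gamma> (t *\<^sub>R \<xi>)"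
      by (simp add: linear_scale[OF linear_omega] mm.scaleR_right)
    show "hor_lift f L \<xi> = hor f L (Diag L ** \<xi>)" by (rule hor_lift_eq[OF L \<xi>])
    show "QLC f \<Gamma> \<xi> \<xi> =
        lt_inner (f (matrix_inv \<Gamma> ** hor f \<Gamma> \<xi>)) (matrix_inv \<Gamma> ** hor f \<Gamma> \<xi>)"
      by (simp add: hor matrix_inv_left_mult LTpos_invertible LT1_LTpos \<Gamma> QLC_eq \<xi> Q_eq omega_LTri LT0_LTri)
    show "t *\<^sub>R hor f \<Gamma> \<xi> \<in> riem_exp_domain LTri LTpos (LC f) \<Gamma>"
      "t *\<^sub>R \<xi> \<in> riem_exp_domain LT0 LT1 (QLC f) \<Gamma>"
      "riem_exp LT0 LT1 (QLC f) \<Gamma> (t *\<^sub>R \<xi>) =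
        matrix_inv (Diag (riem_exp LTri LTpos (LC f) \<Gamma> (t *\<^sub>R hor f \<Gamma> \<xi>)))
          ** riem_exp LTri LTpos (LC f) \<Gamma> (t *\<^sub>R hor f \<Gamma> \<xi>)"
      using QLC_exp[OF \<Gamma> t\<xi>] unfolding thor lt_proj_def by blast+
  qed
qed

end
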